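(* Let $d\ge1$, let $\alpha\in\mathbb{T}^d$ be rationally independent and $\omega\in\mathbb{T}$. Let $V(\theta)=V(\theta_1,\dots,\theta_d)\in C^\omega(\mathbb{T}^d,\mathbb{C})$ be real analytic (complex-valued), and suppose there exists $\tilde\theta\in\mathbb{T}^d$ such that the $d\times 2$ matrix $$\Big(\frac{\partial(\Re V)}{\partial\theta_i}(\tilde\theta),\ \frac{\partial(\Im V)}{\partial\theta_i}(\tilde\theta)\Big)_{1\le i\le d}$$ has rank $2$. If $\lambda\in\mathbb{C}$ satisfies $|\lambda|<e^{\min_{z\in\mathbb{C}}G_d(z)}$, then the operator $H^V_\alpha(\lambda,\omega)$ has two-dimensional spectrum.
   Context: $\mathbb{T}=\mathbb{R}/\mathbb{Z}$. A vector $\alpha\in\mathbb{T}^d$ is rationally independent if $(1,\alpha_1,\dots,\alpha_d)$ is linearly independent over $\mathbb{Q}$. Write $V(\theta)=\sum_{k\in\mathbb{Z}^d}v_k e^{2\pi i\langle k,\theta\rangle}$. The operator $H^V_\alpha(\lambda,\omega)$ acts on $\ell^2(\mathbb{Z}^d)$ by $$(H^V_\alpha(\lambda,\omega)u)(n)=\sum_{k\in\mathbb{Z}^d}v_k u(n-k)+\lambda e^{2\pi i(\omega+\langle n,\alpha\rangle)}u(n),\quad n\in\mathbb{Z}^d.$$ $G_d(z)=\int_{\mathbb{T}^d}\log|z-V(\theta)|\,d\theta$ (for the functions $V$ considered, $G_d$ attains its minimum on $\mathbb{C}$). "Two-dimensional spectrum" means that the spectrum, as a subset of $\mathbb{C}\cong\mathbb{R}^2$,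 has non-empty interior. *)

theory Defs
  imports "HOL-Analysis.Analysis"
begin

text \<open>Points of the torus are given by representatives in \<open>real ^ 'd\<close> (resp. \<open>real\<close>), functions on the
  torus by \<open>\<int>\<^sup>d\<close>-periodic functions, and \<open>\<int>\<^sup>d\<close> is \<open>int ^ 'd\<close>.\<close>

definition lat :: "int ^ 'd \<Rightarrow> real ^ 'd" where
  "lat k = (\<chi> i. real_of_int (k $ i))"

definition torus_periodic :: "(real ^ 'd \<Rightarrow> complex) \<Rightarrow> bool" where
  "torus_periodic V \<longleftrightarrow> (\<forall>\<theta> k. V (\<theta> + lat k) = V \<theta>)"

text \<open>Local expansion into a power series in \<open>d\<close> real variables. The \<open>m\<close> are multi-indices, and
  \<open>has_sum\<close> is unconditional summation over all of them.\<close>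

definition real_analytic :: "(real ^ 'd \<Rightarrow> complex) \<Rightarrow> bool" where
  "real_analytic f \<longleftrightarrow> (\<forall>x. \<exists>r>0. \<exists>a :: ('d \<Rightarrow> nat) \<Rightarrow> complex. \<forall>y. dist x y < r \<longrightarrow>
     ((\<lambda>m. a m * complex_of_real (\<Prod>i\<in>UNIV. (y $ i - x $ i) ^ m i)) has_sum f y) UNIV)"

definition rationally_independent :: "real ^ 'd \<Rightarrow> bool" where
  "rationally_independent \<alpha> \<longleftrightarrow> (\<forall>(q0::rat) (q :: 'd \<Rightarrow> rat).
     of_rat q0 + (\<Sum>i\<in>UNIV. of_rat (q i) * \<alpha> $ i) = 0 \<longrightarrow> q0 = 0 \<and> (\<forall>i. q i = 0))"

definition partial_deriv :: "'d \<Rightarrow> (real ^ 'd \<Rightarrow> real) \<Rightarrow> real ^ 'd \<Rightarrow> real" where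
  "partial_deriv i f \<theta> = deriv (\<lambda>t. f (\<theta> + t *\<^sub>R axis i 1)) 0"

text \<open>The \<open>d \<times> 2\<close> matrix of partial derivatives of the real and imaginary parts.\<close>

definition ReIm_jacobian :: "(real ^ 'd \<Rightarrow> complex) \<Rightarrow> real ^ 'd \<Rightarrow> real ^ 2 ^ 'd" where
  "ReIm_jacobian V \<theta> = (\<chi> i. vector [partial_deriv i (\<lambda>x. Re (V x)) \<theta>,
                                    partial_deriv i (\<lambda>x. Im (V x)) \<theta>])"

definition fourier_coeff :: "(real ^ 'd \<Rightarrow> complex) \<Rightarrow> int ^ 'd \<Rightarrow> complex" where
  "fourier_coeff V k = (LINT \<theta>:cbox 0 1|lborel. V \<theta> * cis (- (2 * pi * (lat k \<bullet> \<theta>))))"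

text \<open>The convention \<open>ln 0 = 0\<close> is harmless where \<open>V \<theta> = z\<close> only on a null set, which is the case
  for every nonconstant real analytic \<open>V\<close>.\<close>

definition G :: "(real ^ 'd \<Rightarrow> complex) \<Rightarrow> complex \<Rightarrow> real" where
  "G V z = (LINT \<theta>:cbox 0 1|lborel. ln (cmod (z - V \<theta>)))"

text \<open>This is \<open>exp (min G)\<close>: \<open>exp\<close> is increasing, so the infimum is attained exactly where \<open>G V\<close> attains
  its minimum. Taking it outside \<open>exp\<close> keeps it over a set of reals bounded below by \<open>0\<close>.\<close>

definition exp_min_G :: "(real ^ 'd \<Rightarrow> complex) \<Rightarrow> real" where
  "exp_min_G V = (INF z. exp (G V z))"

definition ell2 :: "('a \<Rightarrow> complex) set" where
  "ell2 = {u. (\<lambda>n. (cmod (u n))\<^sup>2) summable_on UNIV}"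

definition ell2_norm :: "('a \<Rightarrow> complex) \<Rightarrow> real" where
  "ell2_norm u = sqrt (\<Sum>\<^sub>\<infinity>n. (cmod (u n))\<^sup>2)"

definition bounded_op :: "(('a \<Rightarrow> complex) \<Rightarrow> ('a \<Rightarrow> complex)) \<Rightarrow> bool" where
  "bounded_op T \<longleftrightarrow>
     (\<forall>u\<in>ell2. T u \<in> ell2) \<and>
     (\<forall>u\<in>ell2. \<forall>w\<in>ell2. T (\<lambda>n. u n + w n) = (\<lambda>n. T u n + T w n)) \<and>
     (\<forall>c. \<forall>u\<in>ell2. T (\<lambda>n. c * u n) = (\<lambda>n. c * T u n)) \<and>
     (\<exists>C. \<forall>u\<in>ell2. ell2_norm (T u) \<le> C * ell2_norm u)"

text \<open>Spectrum on \<open>\<ell>\<^sup>2\<close>: those \<open>z\<close> for which \<open>T - z\<close> has no bounded two-sided inverse on \<open>ell2\<close>.\<close>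

definition ell2_spectrum :: "(('a \<Rightarrow> complex) \<Rightarrow> ('a \<Rightarrow> complex)) \<Rightarrow> complex set" where
  "ell2_spectrum T = {z. \<not> (\<exists>R. bounded_op R \<and>
     (\<forall>u\<in>ell2. R (\<lambda>n. T u n - z * u n) = u) \<and>
     (\<forall>u\<in>ell2. (\<lambda>n. T (R u) n - z * R u n) = u))}"

definition H :: "(real ^ 'd \<Rightarrow> complex) \<Rightarrow> real ^ 'd \<Rightarrow> complex \<Rightarrow> real \<Rightarrow>
    (int ^ 'd \<Rightarrow> complex) \<Rightarrow> (int ^ 'd \<Rightarrow> complex)" where
  "H V \<alpha> lam \<omega> u n = (\<Sum>\<^sub>\<infinity>k. fourier_coeff V k * u (n - k))
                     + lam * cis (2 * pi * (\<omega> + lat n \<bullet> \<alpha>)) * u n"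

definition two_dimensional :: "complex set \<Rightarrow> bool" where
  "two_dimensional S \<longleftrightarrow> interior S \<noteq> {}"

end

theory Submission
  imports Defs
begin

text \<open>
  Put \<open>\<lambda>' = lam * cis (2 * pi * \<omega>)\<close>. After Fourier transformation \<open>H\<close> becomes multiplication by \<open>V\<close> plus
  \<open>\<lambda>'\<close> times the translation by \<open>\<alpha>\<close> on the torus. The proof shows that every interior point of the range
  of \<open>V\<close> lies in the spectrum (\<open>interior_range_subset_spectrum\<close>); the rank condition makes \<open>V\<close> open at
  \<open>\<theta>t\<close>, so there are such points (\<open>value_interior_of_range\<close>).

  Let \<open>z0\<close> be an interior point of the range and suppose that \<open>H - z0\<close> has a bounded inverse. By duality
  \<open>\<parallel>f\<parallel> \<le> C \<parallel>(H - z0)\<^sup>* f\<parallel>\<close> for finitely supported \<open>f\<close>, and the same holds with \<open>2 C\<close> for all \<open>z\<close> close to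
  \<open>z0\<close> (\<open>resolvent_dual_lower_bound\<close>, \<open>dual_lower_bound_nearby\<close>). Such a bound is tested on plane waves.
  The adjoint \<open>(H - z)\<^sup>*\<close> sends the wave \<open>e\<^sub>x\<close>, \<open>e\<^sub>x n = cis (- 2 * pi * (lat n \<bullet> x))\<close>, to
  \<open>cnj (V x - z) e\<^sub>x + cnj \<lambda>' e\<^sub>y\<close> with \<open>y = x + \<alpha>\<close>. Choose \<open>\<theta>0\<close> with \<open>V \<theta>0 = z\<close>, and put
  \<open>x\<^sub>j = \<theta>0 + j \<alpha>\<close>. The coefficients \<open>c\<^sub>j\<close> of a combination of the waves at \<open>x\<^sub>0, ..., x\<^sub>m\<close> with \<open>m = N - 1\<close> can be
  chosen so that everything cancels except \<open>(cnj \<lambda>')\<^sup>N\<close> times the wave at \<open>x\<^sub>N\<close>: the telescoping sum has no term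
  at its lower end, because \<open>V - z\<close> vanishes at \<open>x\<^sub>0\<close>. As distinct waves are orthogonal in mean, each
  \<open>c\<^sub>j\<close> is at most \<open>2 C \<bar>lam\<bar>\<^sup>N\<close> in modulus, which says that the product of \<open>\<bar>V - z\<bar>\<close> over any \<open>n\<close> consecutive points of
  the forward orbit of \<open>\<theta>0\<close> is at most \<open>2 C \<bar>lam\<bar>\<^sup>k\<close> with \<open>k = n + 1\<close> (\<open>orbit_product_bound\<close>).
  The orbit is dense by Kronecker's theorem, so the bound holds along every orbit
  (\<open>periodic_le_of_orbit\<close>). Integrating the logarithm over the torus, dividing by \<open>n\<close> and letting \<open>n\<close> grow gives
  \<open>G V z \<le> ln \<bar>lam\<bar>\<close> (\<open>log_mean_le_of_product_bound\<close>), against \<open>cmod lam < exp_min_G V\<close>.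

  Two points need care. Plane waves are not square summable; they are cut off to finite sets \<open>F\<close> of lattice
  points with small boundary, and Bessel's inequality bounds the error, since the associated
  trigonometric polynomial concentrates at one point of the torus (\<open>wave_almost_eigen\<close>). Secondly,
  \<open>G V z\<close> is the intended integral only if \<open>V \<noteq> z\<close> almost everywhere and the logarithm is integrable. The
  function \<open>ln \<bar>t\<bar>\<close> of one real variable is locally integrable, so by Fubini's theorem this is the case for almost every
  \<open>z\<close> on the horizontal line through \<open>z0\<close> (\<open>generic_log_integrable\<close>); hence the passage from \<open>z0\<close> to a nearby \<open>z\<close>.
\<close>

section \<open>Integration over the torus\<close>

text \<open>The half-open cube is an exact fundamental domain of \<open>\<int>\<^sup>d\<close>, the closed cube is one only up to a null set.\<close>

definition half_open_cube :: "(real ^ 'd) set" where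
  "half_open_cube = {x. \<forall>i. 0 \<le> x $ i \<and> x $ i < 1}"

definition torus :: "(real ^ 'd) measure" where
  "torus = density lborel (indicator (cbox 0 1))"

lemma half_open_cube_borel [measurable]: "half_open_cube \<in> sets borel"
proof -
  have "half_open_cube = (\<Inter>i\<in>UNIV. {x::real^'d. 0 \<le> x $ i} \<inter> {x. x $ i < 1})"
    by (auto simp: half_open_cube_def)
  also have "\<dots> \<in> sets borel"
    by (intro sets.finite_INT sets.Int borel_closed borel_open closed_halfspace_component_ge_cart
        open_halfspace_component_lt_cart) auto
  finally show ?thesis .
qed

lemma AE_closed_iff_half_open_cube: "AE x in lborel. x \<in> cbox 0 1 \<longleftrightarrow> x \<in> (half_open_cube :: (real^'d) set)"
proof (rule AE_I)
  let ?N = "\<Union>i\<in>UNIV. {x::real^'d. x $ i = 1}"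
  show "{x \<in> space lborel. \<not> (x \<in> cbox 0 1 \<longleftrightarrow> x \<in> (half_open_cube :: (real^'d) set))} \<subseteq> ?N"
    by (auto simp: half_open_cube_def mem_box_cart less_imp_le) (metis less_eq_real_def)
  have *: "{x::real^'d. x $ i = 1} \<in> null_sets lborel" for i
  proof -
    have "negligible {x::real^'d. x $ i = 1}"
      using negligible_standard_hyperplane[of "axis i 1 :: real^'d" 1] by (simp add: inner_axis axis_in_Basis_iff)
    moreover have "{x::real^'d. x $ i = 1} \<in> sets borel"
      by (intro borel_closed closed_Collect_eq continuous_intros)
    ultimately show ?thesis
      by (simp add: negligible_iff_null_sets null_sets_completion_iff)
  qed
  have "?N \<in> null_sets lborel"
    by (intro null_sets_UN' *) (auto intro: countable_finite)
  then show "?N \<in> sets lborel" "emeasure lborel ?N = 0" by (auto simp: null_sets_def)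
qed

lemma sets_torus [simp, measurable_cong]: "sets torus = sets borel"
  by (simp add: torus_def)

lemma space_torus [simp]: "space torus = UNIV"
  by (simp add: torus_def)

lemma torus_half_open: "torus = density lborel (indicator (half_open_cube :: (real^'d) set))"
  unfolding torus_def using AE_closed_iff_half_open_cube
  by (intro density_cong) (auto simp: indicator_def elim: eventually_mono)

lemma emeasure_torus_UNIV [simp]: "emeasure (torus :: (real^'d) measure) UNIV = 1"
proof -
  have "emeasure (torus :: (real^'d) measure) UNIV = emeasure lborel (cbox 0 (1::real^'d))"
    by (simp add: torus_def emeasure_density)
  also have "\<dots> = 1"
    by (subst emeasure_lborel_cbox_eq) (auto simp: Basis_vec_def inner_axis intro!: prod.neutral)
  finally show ?thesis .
qed

lemma finite_measure_torus: "finite_measure torus"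
  by (rule finite_measureI) simp

lemma LINT_cube_eq_torus:
  fixes f :: "real^'d \<Rightarrow> 'b::{banach, second_countable_topology}"
  assumes "f \<in> borel_measurable borel"
  shows "(LINT x:cbox 0 1|lborel. f x) = integral\<^sup>L torus f"
proof -
  have *: "torus = density lborel (\<lambda>x. ennreal (indicator (cbox 0 (1::real^'d)) x))"
    unfolding torus_def by (rule arg_cong[where f="density lborel"]) (auto simp: indicator_def fun_eq_iff)
  show ?thesis
    unfolding set_lebesgue_integral_def * using assms by (subst integral_density) auto
qed

lemma lat_add: "lat (k + l) = lat k + lat l"
  by (simp add: lat_def vec_eq_iff)
lemma lat_minus: "lat (- k) = - lat k"
  by (simp add: lat_def vec_eq_iff)
lemma lat_0 [simp]: "lat 0 = 0"
  by (simp add: lat_def vec_eq_iff)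

lemma lat_tile: fixes x :: "real^'d" shows "\<exists>k0. \<forall>k. x - lat k \<in> half_open_cube \<longleftrightarrow> k = k0"
proof (intro exI allI)
  fix k :: "int^'d"
  show "x - lat k \<in> half_open_cube \<longleftrightarrow> k = (\<chi> i. \<lfloor>x $ i\<rfloor>)"
    by (simp add: half_open_cube_def lat_def vec_eq_iff eq_commute[of _ "\<lfloor>_\<rfloor>"] floor_eq_iff algebra_simps)
qed

lemma tile_count:
  "(\<integral>\<^sup>+k. indicator half_open_cube (x - lat k) \<partial>count_space UNIV) = (1::ennreal)" (is ?A)
  "(\<integral>\<^sup>+k. indicator half_open_cube (x + lat k) \<partial>count_space UNIV) = (1::ennreal)" (is ?B)
proof -
  obtain k0 where k0: "\<And>k. x - lat k \<in> half_open_cube \<longleftrightarrow> k = k0"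
    using lat_tile by blast
  have "(\<integral>\<^sup>+k. indicator half_open_cube (x - lat k) \<partial>count_space UNIV)
      = (\<integral>\<^sup>+k. indicator {k0} k \<partial>count_space UNIV)"
    by (intro nn_integral_cong) (auto simp: indicator_def k0)
  then show ?A by simp
  have k1: "x + lat k \<in> half_open_cube \<longleftrightarrow> k = - k0" for k
    using k0[of "- k"] by (auto simp: lat_minus)
  have "(\<integral>\<^sup>+k. indicator half_open_cube (x + lat k) \<partial>count_space UNIV)
      = (\<integral>\<^sup>+k. indicator {- k0} k \<partial>count_space UNIV)"
    by (intro nn_integral_cong) (auto simp: indicator_def k1)
  then show ?B by simp
qed

lemma nn_integral_lborel_shift:
  fixes f :: "'a::euclidean_space \<Rightarrow> ennreal"
  assumes [measurable]: "f \<in> borel_measurable borel"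
  shows "(\<integral>\<^sup>+x. f (c + x) \<partial>lborel) = (\<integral>\<^sup>+x. f x \<partial>lborel)"
proof -
  have "(\<integral>\<^sup>+x. f x \<partial>lborel) = (\<integral>\<^sup>+x. f x \<partial>distr lborel borel ((+) c))"
    by (simp add: lborel_distr_plus)
  also have "\<dots> = (\<integral>\<^sup>+x. f (c + x) \<partial>lborel)"
    by (subst nn_integral_distr) auto
  finally show ?thesis by simp
qed

text \<open>A translated cube is cut along the lattice into pieces, and the pieces, moved back by lattice vectors, tile the
  cube again. The pieces are handled by inserting the sum over all lattice translates of the
  indicator function of the cube, which is identically \<open>1\<close>.\<close>

lemma nn_integral_torus_shift:
  fixes f :: "real^'d \<Rightarrow> ennreal"
  assumes [measurable]: "f \<in> borel_measurable borel" and per: "\<And>x k. f (x + lat k) = f x"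
  shows "(\<integral>\<^sup>+x. f (x + a) \<partial>torus) = (\<integral>\<^sup>+x. f x \<partial>torus)"
proof -
  let ?C = "indicator half_open_cube :: real^'d \<Rightarrow> ennreal"
  have *: "(\<integral>\<^sup>+x. g x \<partial>torus) = (\<integral>\<^sup>+x. ?C x * g x \<partial>lborel)"
    if "g \<in> borel_measurable borel" for g :: "real^'d \<Rightarrow> ennreal"
    using that unfolding torus_half_open by (subst nn_integral_density) auto
  have "(\<integral>\<^sup>+x. f (x + a) \<partial>torus) = (\<integral>\<^sup>+x. ?C x * f (x + a) \<partial>lborel)"
    by (rule *) measurable
  also have "\<dots> = (\<integral>\<^sup>+x. (\<integral>\<^sup>+k. ?C x * f (x + a) * ?C ((x + a) - lat k) \<partial>count_space UNIV) \<partial>lborel)"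
    by (subst nn_integral_cmult) (auto simp: tile_count)
  also have "\<dots> = (\<integral>\<^sup>+k. (\<integral>\<^sup>+x. ?C x * f (x + a) * ?C ((x + a) - lat k) \<partial>lborel) \<partial>count_space UNIV)"
    by (rule nn_integral_count_space_nn_integral[OF countableI_type]) measurable
  also have "\<dots> = (\<integral>\<^sup>+k. (\<integral>\<^sup>+x. ?C x * f x * ?C ((x - a) + lat k) \<partial>lborel) \<partial>count_space UNIV)"
  proof (rule nn_integral_cong)
    fix k :: "int^'d"
    let ?g = "\<lambda>x. ?C x * f x * ?C ((x - a) + lat k)"
    have "(\<integral>\<^sup>+x. ?g x \<partial>lborel) = (\<integral>\<^sup>+x. ?g ((a - lat k) + x) \<partial>lborel)"
      by (rule nn_integral_lborel_shift[symmetric]) measurable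
    also have "\<dots> = (\<integral>\<^sup>+x. ?C x * f (x + a) * ?C ((x + a) - lat k) \<partial>lborel)"
    proof (intro nn_integral_cong)
      fix x :: "real^'d"
      have "f (a - lat k + x) = f (x + a)"
        using per[of "a - lat k + x" k] by (simp add: algebra_simps)
      then show "?g ((a - lat k) + x) = ?C x * f (x + a) * ?C ((x + a) - lat k)"
        by (simp add: algebra_simps)
    qed
    finally show "(\<integral>\<^sup>+x. ?C x * f (x + a) * ?C ((x + a) - lat k) \<partial>lborel) = (\<integral>\<^sup>+x. ?g x \<partial>lborel)"
      by simp
  qed
  also have "\<dots> = (\<integral>\<^sup>+x. (\<integral>\<^sup>+k. ?C x * f x * ?C ((x - a) + lat k) \<partial>count_space UNIV) \<partial>lborel)"
    by (rule nn_integral_count_space_nn_integral[OF countableI_type, symmetric]) measurable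
  also have "\<dots> = (\<integral>\<^sup>+x. ?C x * f x \<partial>lborel)"
    by (subst nn_integral_cmult) (auto simp: tile_count)
  also have "\<dots> = (\<integral>\<^sup>+x. f x \<partial>torus)"
    by (rule *[symmetric]) measurable
  finally show ?thesis .
qed


lemma integral_torus_shift_real:
  fixes f :: "real^'d \<Rightarrow> real"
  assumes int: "integrable torus f" and per: "\<And>x k. f (x + lat k) = f x"
  shows "integrable torus (\<lambda>x. f (x + a))"
    and "(\<integral>x. f (x + a) \<partial>torus) = (\<integral>x. f x \<partial>torus)"
proof -
  have [measurable]: "f \<in> borel_measurable borel"
    using borel_measurable_integrable[OF int] by (simp cong: measurable_cong_sets)
  have nn: "(\<integral>\<^sup>+x. ennreal (h (f (x + a))) \<partial>torus) = (\<integral>\<^sup>+x. ennreal (h (f x)) \<partial>torus)"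
    if [measurable]: "h \<in> borel_measurable borel" for h :: "real \<Rightarrow> real"
    by (rule nn_integral_torus_shift[where f="\<lambda>x. ennreal (h (f x))"]) (auto simp: per)
  show i: "integrable torus (\<lambda>x. f (x + a))"
    using int nn[of norm] by (auto simp: integrable_iff_bounded)
  show "(\<integral>x. f (x + a) \<partial>torus) = (\<integral>x. f x \<partial>torus)"
    using nn[of "\<lambda>x. x"] nn[of uminus] by (simp add: real_lebesgue_integral_def[OF int] real_lebesgue_integral_def[OF i])
qed

lemma integral_torus_shift:
  fixes f :: "real^'d \<Rightarrow> complex"
  assumes int: "integrable torus f" and per: "\<And>x k. f (x + lat k) = f x"
  shows "(\<integral>x. f (x + a) \<partial>torus) = (\<integral>x. f x \<partial>torus)"
proof -
  have Re: "integrable torus (\<lambda>x. Re (f x))" and Im: "integrable torus (\<lambda>x. Im (f x))"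
    using int by auto
  have "integrable torus (\<lambda>x. complex_of_real (Re (f (x + a))) + \<i> * complex_of_real (Im (f (x + a))))"
    using integral_torus_shift_real(1)[OF Re, of a] integral_torus_shift_real(1)[OF Im, of a]
    by (intro Bochner_Integration.integrable_add integrable_mult_right integrable_of_real) (auto simp: per)
  then have "integrable torus (\<lambda>x. f (x + a))"
    by (simp flip: complex_eq)
  then show ?thesis
    using integral_torus_shift_real(2)[OF Re, of a] integral_torus_shift_real(2)[OF Im, of a] int
    by (simp add: per complex_eq_iff)
qed


section \<open>Characters, Parseval and Bessel\<close>

definition character :: "int^'d \<Rightarrow> real^'d \<Rightarrow> complex" where
  "character k x = cis (2 * pi * (lat k \<bullet> x))"

lemma norm_char [simp]: "cmod (character k x) = 1"
  by (simp add: character_def)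
lemma character_0 [simp]: "character 0 x = 1" "character k 0 = 1"
  by (simp_all add: character_def)
lemma character_add: "character (k + l) x = character k x * character l x"
  by (simp add: character_def lat_add inner_left_distrib cis_mult algebra_simps)
lemma character_add_right: "character k (x + y) = character k x * character k y"
  by (simp add: character_def inner_right_distrib cis_mult algebra_simps)
lemma character_minus: "character (- k) x = cnj (character k x)" "character k (- x) = cnj (character k x)"
  by (simp_all add: character_def lat_minus cis_cnj)
lemma character_diff: "character (k - l) x = character k x * cnj (character l x)"
  using character_add[of k "- l" x] by (simp add: character_minus)
lemma character_diff_right: "character k (x - y) = character k x * cnj (character k y)"
  using character_add_right[of k x "- y"] by (simp add: character_minus)
lemma lat_inner_lat: "lat k \<bullet> lat l = of_int (\<Sum>i\<in>UNIV. k $ i * l $ i)"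
  by (simp add: lat_def inner_vec_def)

lemma character_lat [simp]: "character k (lat l) = 1"
  by (metis character_def lat_inner_lat cis_multiple_2pi Ints_of_int)

lemma character_periodic: "character k (x + lat l) = character k x"
  by (simp add: character_add_right)

lemma continuous_on_character [continuous_intros]: "continuous_on S (character k)"
  unfolding character_def[abs_def] by (intro continuous_intros)

lemma character_measurable [measurable]: "character k \<in> borel_measurable borel"
  by (intro borel_measurable_continuous_onI continuous_intros)

lemma cnj_measurable [measurable (raw)]:
  "f \<in> borel_measurable M \<Longrightarrow> (\<lambda>x. cnj (f x)) \<in> borel_measurable M"
  by (rule borel_measurable_continuous_on[where f=cnj]) (auto intro!: continuous_intros)

lemma integrable_torus_bounded:
  fixes f :: "real^'d \<Rightarrow> 'b::{banach, second_countable_topology}"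
  assumes "f \<in> borel_measurable borel" "\<And>x. norm (f x) \<le> B"
  shows "integrable torus f"
  using assms by (intro finite_measure.integrable_const_bound[OF finite_measure_torus, of _ B])
    (auto cong: measurable_cong_sets)

text \<open>If \<open>k \<noteq> 0\<close>, some translation multiplies the character by \<open>-1\<close> but leaves its integral unchanged.\<close>

lemma integral_torus_character:
  fixes k :: "int^'d"
  shows "(\<integral>x. character k x \<partial>torus) = (if k = 0 then 1 else 0)"
proof (cases "k = 0")
  case True
  then show ?thesis by (simp add: measure_def)
next
  case False
  then obtain i where i: "k $ i \<noteq> 0" by (auto simp: vec_eq_iff)
  \<comment> \<open>a translation by which the character changes its sign\<close>
  let ?a = "axis i (1 / (2 * real_of_int (k $ i))) :: real^'d"
  have a: "character k ?a = -1"
    using i by (simp add: character_def inner_axis lat_def)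
  have "(\<integral>x. character k (x + ?a) \<partial>torus) = (\<integral>x. character k x \<partial>torus)"
    by (rule integral_torus_shift) (auto simp: character_periodic intro!: integrable_torus_bounded[where B=1])
  then have "- (\<integral>x. character k x \<partial>torus) = (\<integral>x. character k x \<partial>torus)"
    by (simp add: character_add_right a)
  then have "2 * (\<integral>x. character k x \<partial>torus) = 0"
    by (metis mult_2 add.right_inverse)
  then show ?thesis using False by simp
qed


lemma parseval_finite:
  assumes "finite S"
  shows "(\<integral>x. (cmod (\<Sum>n\<in>S. c n * character n x))\<^sup>2 \<partial>torus) = (\<Sum>n\<in>S. (cmod (c n))\<^sup>2)"
proof -
  have "complex_of_real (\<integral>x. (cmod (\<Sum>n\<in>S. c n * character n x))\<^sup>2 \<partial>torus)
      = (\<integral>x. (\<Sum>n\<in>S. \<Sum>m\<in>S. (c n * cnj (c m)) * character (n - m) x) \<partial>torus)"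
    unfolding integral_complex_of_real[symmetric]
    by (intro Bochner_Integration.integral_cong)
      (simp_all add: complex_norm_square sum_product character_diff mult_ac flip: of_real_power)
  also have "\<dots> = (\<Sum>n\<in>S. \<Sum>m\<in>S. (c n * cnj (c m)) * (\<integral>x. character (n - m) x \<partial>torus))"
    by (simp add: Bochner_Integration.integral_sum integrable_torus_bounded[where B=1])
  also have "\<dots> = (\<Sum>n\<in>S. c n * cnj (c n))"
    using assms by (simp add: integral_torus_character if_distrib[of "\<lambda>t. _ * t"] sum.delta' cong: if_cong)
  also have "\<dots> = complex_of_real (\<Sum>n\<in>S. (cmod (c n))\<^sup>2)"
    by (simp add: complex_norm_square del: of_real_power)
  finally show ?thesis by (simp only: of_real_eq_iff)
qed

text \<open>With \<open>p\<close> the partial Fourier sum, this is \<open>\<integral> \<bar>h - p\<bar>\<^sup>2 \<ge> 0\<close> expanded.\<close>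

lemma bessel:
  assumes h [measurable]: "h \<in> borel_measurable borel" and B: "\<And>x. cmod (h x) \<le> B" and "finite S"
  shows "(\<Sum>n\<in>S. (cmod (\<integral>x. h x * cnj (character n x) \<partial>torus))\<^sup>2) \<le> (\<integral>x. (cmod (h x))\<^sup>2 \<partial>torus)"
proof -
  define c where "c n = (\<integral>x. h x * cnj (character n x) \<partial>torus)" for n
  define p where "p x = (\<Sum>n\<in>S. c n * character n x)" for x
  have [measurable]: "p \<in> borel_measurable borel" unfolding p_def[abs_def] by measurable
  have pB: "cmod (p x) \<le> (\<Sum>n\<in>S. cmod (c n))" for x
    unfolding p_def by (rule order_trans[OF norm_sum]) (simp add: norm_mult)
  have B0: "B \<ge> 0" using B[of 0] norm_ge_zero order_trans by blast
  have ihh: "integrable torus (\<lambda>x. (cmod (h x))\<^sup>2)"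
    using B by (intro integrable_torus_bounded[where B="B\<^sup>2"]) (auto intro!: power_mono)
  have ipp: "integrable torus (\<lambda>x. (cmod (p x))\<^sup>2)"
    using pB by (intro integrable_torus_bounded[where B="(\<Sum>n\<in>S. cmod (c n))\<^sup>2"]) (auto intro!: power_mono)
  have ihc: "integrable torus (\<lambda>x. h x * cnj (character n x))" for n
    using B by (intro integrable_torus_bounded[where B=B]) (auto simp: norm_mult)
  have ihp: "integrable torus (\<lambda>x. h x * cnj (p x))"
    using pB B B0 by (intro integrable_torus_bounded[where B="B * (\<Sum>n\<in>S. cmod (c n))"]) 
       (auto simp: norm_mult intro!: mult_mono)
  have "(\<integral>x. h x * cnj (p x) \<partial>torus) = (\<integral>x. (\<Sum>n\<in>S. cnj (c n) * (h x * cnj (character n x))) \<partial>torus)"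
    by (intro Bochner_Integration.integral_cong) (simp_all add: p_def sum_distrib_left mult_ac)
  also have "\<dots> = (\<Sum>n\<in>S. cnj (c n) * c n)"
    by (simp add: Bochner_Integration.integral_sum ihc c_def)
  also have "\<dots> = complex_of_real (\<Sum>n\<in>S. (cmod (c n))\<^sup>2)"
    by (simp add: complex_norm_square mult.commute del: of_real_power)
  finally have *: "(\<integral>x. h x * cnj (p x) \<partial>torus) = complex_of_real (\<Sum>n\<in>S. (cmod (c n))\<^sup>2)" .
  define r where "r x = Re (h x * cnj (p x))" for x
  have ir: "integrable torus r" and hp: "(\<integral>x. r x \<partial>torus) = (\<Sum>n\<in>S. (cmod (c n))\<^sup>2)"
    unfolding r_def[abs_def] integral_Re[OF ihp] * by (rule integrable_Re[OF ihp], rule Re_complex_of_real)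
  have pp: "(\<integral>x. (cmod (p x))\<^sup>2 \<partial>torus) = (\<Sum>n\<in>S. (cmod (c n))\<^sup>2)"
    unfolding p_def by (rule parseval_finite) fact
  have "0 \<le> (\<integral>x. (cmod (h x - p x))\<^sup>2 \<partial>torus)"
    by (rule Bochner_Integration.integral_nonneg) simp
  also have "\<dots> = (\<integral>x. (cmod (h x))\<^sup>2 - 2 * r x + (cmod (p x))\<^sup>2 \<partial>torus)"
    by (intro Bochner_Integration.integral_cong)
       (simp_all only: cmod_power2, simp_all add: r_def power2_eq_square algebra_simps)
  also have "\<dots> = (\<integral>x. (cmod (h x))\<^sup>2 \<partial>torus) - 2 * (\<Sum>n\<in>S. (cmod (c n))\<^sup>2) + (\<Sum>n\<in>S. (cmod (c n))\<^sup>2)"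
    using ihh ipp ir hp pp by simp
  finally show ?thesis by (simp add: c_def)
qed

section \<open>Finite subsets of the lattice with small boundary\<close>

abbreviation unit_shift :: "'d \<Rightarrow> (int^'d) set \<Rightarrow> (int^'d) set" where
  "unit_shift i F \<equiv> (\<lambda>n. n + axis i 1) ` F"

text \<open>Such sets are called Foelner sets: moving \<open>F\<close> by a unit vector changes only a proportion \<open>e\<close> of its points.\<close>

definition folner :: "real \<Rightarrow> (int^'d) set \<Rightarrow> bool" where
  "folner e F \<longleftrightarrow> finite F \<and> F \<noteq> {} \<and>
     (\<forall>i. real (card (unit_shift i F - F)) \<le> e * card F \<and> real (card (F - unit_shift i F)) \<le> e * card F)"

lemma folner_card:
  assumes "folner e F"
  shows "real (card (unit_shift i F - F)) + real (card (F - unit_shift i F)) \<le> 2 * e * card F"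
proof -
  have "real (card (unit_shift i F - F)) \<le> e * card F" "real (card (F - unit_shift i F)) \<le> e * card F"
    using assms by (auto simp: folner_def)
  then show ?thesis by linarith
qed

lemma folner_mono: "folner e F \<Longrightarrow> e \<le> e' \<Longrightarrow> folner e' F"
  unfolding folner_def using mult_right_mono[of e e' "real (card F)"] order_trans by fastforce

text \<open>A cube with side length \<open>M > 1 / e\<close> will do: a unit vector moves only one of its \<open>M\<close> parallel slices of equal size
  out of it.\<close>

lemma folner_exists:
  assumes "e > 0"
  shows "\<exists>F :: (int^'d) set. folner e F"
proof -
  obtain M :: nat where M: "1 / e < M" "M > 0"
  proof -
    obtain M :: nat where "1 / e < M" using reals_Archimedean2 by blast
    moreover have "0 < 1 / e" using assms by simp
    ultimately show ?thesis using that[of M] by linarith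
  qed
  define F :: "(int^'d) set" where "F = {n. \<forall>i. 0 \<le> n $ i \<and> n $ i < int M}"
  have fin: "finite F"
  proof (rule finite_subset)
    show "F \<subseteq> (\<lambda>f. \<chi> i. f i) ` (PiE UNIV (\<lambda>_. {0..<int M}))"
    proof
      fix n assume "n \<in> F"
      then have "(\<lambda>i. n $ i) \<in> PiE UNIV (\<lambda>_. {0..<int M})" by (auto simp: F_def)
      then show "n \<in> (\<lambda>f. \<chi> i. f i) ` (PiE UNIV (\<lambda>_. {0..<int M}))"
        by (intro image_eqI[where x="\<lambda>i. n $ i"]) auto
    qed
    show "finite ((\<lambda>f. \<chi> i. f i) ` (PiE UNIV (\<lambda>_. {0..<int M})) :: (int^'d) set)"
      by (intro finite_imageI finite_PiE) auto
  qed
  have ne: "F \<noteq> {}" using M by (auto simp: F_def intro!: exI[of _ 0])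
  have slice: "real (card (F - unit_shift i F)) \<le> e * card F" for i :: 'd
  proof -
    have sub: "F - unit_shift i F \<subseteq> {n \<in> F. n $ i = 0}"
    proof
      fix n assume n: "n \<in> F - unit_shift i F"
      have "n - axis i 1 \<notin> F"
        using n image_eqI[of n "\<lambda>n. n + axis i 1" "n - axis i 1" F] by auto
      then obtain j where j: "\<not> (0 \<le> (n - axis i 1) $ j \<and> (n - axis i 1) $ j < int M)"
        by (auto simp: F_def)
      moreover have b: "0 \<le> n $ j \<and> n $ j < int M" and nF: "n \<in> F"
        using n by (auto simp: F_def)
      ultimately have "j = i" by (cases "j = i") (auto simp: axis_def)
      with j b nF show "n \<in> {n \<in> F. n $ i = 0}"
        by (simp add: axis_def)
    qed
    have "card ({n \<in> F. n $ i = 0} \<times> {0..<int M}) \<le> card F"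
    proof (rule card_inj_on_le[where f="\<lambda>(n, c). n + axis i c"])
      show "inj_on (\<lambda>(n, c). n + axis i c) ({n \<in> F. n $ i = 0} \<times> {0..<int M})"
      proof (rule inj_onI, clarsimp)
        fix n n' :: "int^'d" and c c' :: int assume *: "n + axis i c = n' + axis i c'" "n $ i = 0" "n' $ i = 0"
        have "(n + axis i c) $ i = (n' + axis i c') $ i" using * by simp
        then have "c = c'" using *(2,3) by (simp add: axis_def)
        with * show "n = n' \<and> c = c'" by simp
      qed
      show "(\<lambda>(n, c). n + axis i c) ` ({n \<in> F. n $ i = 0} \<times> {0..<int M}) \<subseteq> F"
        by (auto simp: F_def axis_def)
    qed (rule fin)
    then have "M * card {n \<in> F. n $ i = 0} \<le> card F"
      by (simp add: card_cartesian_product mult.commute)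
    moreover have "card (F - unit_shift i F) \<le> card {n \<in> F. n $ i = 0}"
      using sub fin by (intro card_mono) auto
    ultimately have "M * card (F - unit_shift i F) \<le> card F"
      by (meson le_trans mult_le_mono2)
    then have "real M * real (card (F - unit_shift i F)) \<le> card F"
      unfolding of_nat_mult[symmetric] of_nat_le_iff .
    then have "(e * M) * card (F - unit_shift i F) \<le> e * card F"
      using assms by (simp add: mult.assoc)
    moreover have "1 * real (card (F - unit_shift i F)) \<le> (e * M) * card (F - unit_shift i F)"
      using M assms by (intro mult_right_mono) (auto simp: field_simps)
    ultimately show ?thesis by simp
  qed
  have "card (unit_shift i F - F) = card (F - unit_shift i F)" for i :: 'd
  proof -
    have "card (unit_shift i F) = card F" by (intro card_image) (auto simp: inj_on_def)
    then show ?thesis using fin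
      by (simp add: card_Diff_subset_Int Int_commute)
  qed
  then show ?thesis
    using fin ne slice unfolding folner_def by (intro exI[of _ F]) auto
qed

lemma sum_unit_shift_diff:
  fixes h :: "int^'d \<Rightarrow> complex"
  assumes "finite F"
  shows "(\<Sum>n\<in>F. h (n + axis i 1)) - (\<Sum>n\<in>F. h n) = (\<Sum>n\<in>unit_shift i F - F. h n) - (\<Sum>n\<in>F - unit_shift i F. h n)"
proof -
  have "(\<Sum>n\<in>F. h (n + axis i 1)) = sum h (unit_shift i F)"
    by (subst sum.reindex) (auto simp: inj_on_def)
  moreover have "sum h (unit_shift i F) = sum h (unit_shift i F - F) + sum h (unit_shift i F \<inter> F)"
    using assms by (subst sum.union_disjoint[symmetric]) (auto intro!: sum.cong)
  moreover have "sum h F = sum h (F - unit_shift i F) + sum h (unit_shift i F \<inter> F)"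
    using assms by (subst sum.union_disjoint[symmetric]) (auto intro!: sum.cong)
  ultimately show ?thesis by simp
qed

text \<open>Multiplication by \<open>character (axis i 1) y - 1\<close> turns the sum over \<open>F\<close> into a difference of sums over its boundary.
  So the mean over \<open>F\<close> of the character at \<open>y\<close> is small unless \<open>y\<close> is a lattice point.\<close>

lemma folner_character_mean:
  assumes "folner e F"
  shows "cmod (\<Sum>n\<in>F. character n y) * cmod (character (axis i 1) y - 1) \<le> 2 * e * card F"
proof -
  have fin: "finite F" using assms by (simp add: folner_def)
  have "(\<Sum>n\<in>F. character n y) * (character (axis i 1) y - 1) = (\<Sum>n\<in>F. character (n + axis i 1) y) - (\<Sum>n\<in>F. character n y)"
    by (simp add: character_add sum_distrib_right right_diff_distrib)
  also have "cmod \<dots> \<le> cmod (\<Sum>n\<in>unit_shift i F - F. character n y) + cmod (\<Sum>n\<in>F - unit_shift i F. character n y)"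
    unfolding sum_unit_shift_diff[OF fin, of "\<lambda>n. character n y"] by (rule norm_triangle_ineq4)
  also have "\<dots> \<le> (\<Sum>n\<in>unit_shift i F - F. cmod (character n y)) + (\<Sum>n\<in>F - unit_shift i F. cmod (character n y))"
    by (intro add_mono norm_sum)
  also have "\<dots> \<le> 2 * e * card F"
    using folner_card[OF assms, of i] by simp
  finally show ?thesis by (simp add: norm_mult)
qed

section \<open>Plane waves as approximate eigenvectors of convolution\<close>

text \<open>A plane wave cut off to \<open>F\<close>. The conjugation fixes the direction: multiplication by \<open>cnj (character n \<alpha>)\<close>, as in the
  adjoint of \<open>H\<close>, moves the wave at \<open>x\<close> to the wave at \<open>x + \<alpha>\<close>.\<close>

definition wave :: "(int^'d) set \<Rightarrow> real^'d \<Rightarrow> int^'d \<Rightarrow> complex" where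
  "wave F x n = (if n \<in> F then cnj (character n x) else 0)"

text \<open>The trigonometric polynomial with the wave as its coefficients: the Dirichlet kernel of \<open>F\<close>, moved to \<open>x\<close>.\<close>

definition dirichlet_kernel :: "(int^'d) set \<Rightarrow> real^'d \<Rightarrow> real^'d \<Rightarrow> complex" where
  "dirichlet_kernel F x \<theta> = (\<Sum>n\<in>F. wave F x n * character n \<theta>)"

lemma dirichlet_kernel_eq: "dirichlet_kernel F x \<theta> = (\<Sum>n\<in>F. character n (\<theta> - x))"
  unfolding dirichlet_kernel_def by (intro sum.cong) (auto simp: wave_def character_diff_right)

lemma cmod_dirichlet_kernel_le: "cmod (dirichlet_kernel F x \<theta>) \<le> card F"
  unfolding dirichlet_kernel_eq by (rule order_trans[OF norm_sum]) simp

lemma dirichlet_kernel_measurable [measurable]: "dirichlet_kernel F x \<in> borel_measurable borel"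
  unfolding dirichlet_kernel_def[abs_def] by measurable

lemma dirichlet_kernel_L2: "finite F \<Longrightarrow> (\<integral>\<theta>. (cmod (dirichlet_kernel F x \<theta>))\<^sup>2 \<partial>torus) = card F"
  unfolding dirichlet_kernel_def by (subst parseval_finite) (simp_all add: wave_def)

lemma dirichlet_kernel_coeff:
  assumes "finite F"
  shows "(\<integral>\<theta>. dirichlet_kernel F x \<theta> * cnj (character m \<theta>) \<partial>torus) = wave F x m"
proof -
  have "(\<integral>\<theta>. dirichlet_kernel F x \<theta> * cnj (character m \<theta>) \<partial>torus) = (\<integral>\<theta>. (\<Sum>n\<in>F. wave F x n * character (n - m) \<theta>) \<partial>torus)"
    unfolding dirichlet_kernel_def sum_distrib_right by (simp add: character_diff mult.assoc)
  also have "\<dots> = (\<Sum>n\<in>F. wave F x n * (if n = m then 1 else 0))"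
    by (simp add: Bochner_Integration.integral_sum integrable_torus_bounded[where B=1] integral_torus_character)
  also have "\<dots> = wave F x m"
    using assms by (simp add: if_distrib[of "\<lambda>t. _ * t"] wave_def cong: if_cong)
  finally show ?thesis .
qed

text \<open>The first factor vanishes at \<open>\<theta> = x\<close>. The product of \<open>character (axis i 1) (\<theta> - x) - 1\<close> with the kernel is
  a trigonometric polynomial with unimodular coefficients on the boundary of \<open>F\<close>, so Parseval's identity counts the points of
  that boundary. Compared with the total mass \<open>card F\<close> of the squared kernel, little of it lies away from \<open>x\<close>.\<close>

lemma dirichlet_kernel_concentrated:
  assumes "folner e F"
  shows "(\<integral>\<theta>. (cmod (character (axis i 1) (\<theta> - x) - 1))\<^sup>2 * (cmod (dirichlet_kernel F x \<theta>))\<^sup>2 \<partial>torus) \<le> 2 * e * card F"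
proof -
  have fin: "finite F" using assms by (simp add: folner_def)
  let ?A = "unit_shift i F - F" let ?B = "F - unit_shift i F"
  define c where "c n = (if n \<in> F then - cnj (character n x) else cnj (character n x))" for n
  have "(character (axis i 1) (\<theta> - x) - 1) * dirichlet_kernel F x \<theta> = (\<Sum>n\<in>?A \<union> ?B. c n * character n \<theta>)" for \<theta>
  proof -
    have "(character (axis i 1) (\<theta> - x) - 1) * dirichlet_kernel F x \<theta> 
        = (\<Sum>n\<in>F. character (n + axis i 1) (\<theta> - x)) - (\<Sum>n\<in>F. character n (\<theta> - x))"
      unfolding dirichlet_kernel_eq by (simp add: character_add sum_distrib_left algebra_simps)
    also have "\<dots> = (\<Sum>n\<in>?A. character n (\<theta> - x)) - (\<Sum>n\<in>?B. character n (\<theta> - x))"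
      by (rule sum_unit_shift_diff[OF fin])
    also have "(\<Sum>n\<in>?A. character n (\<theta> - x)) = (\<Sum>n\<in>?A. c n * character n \<theta>)"
      by (intro sum.cong refl) (simp add: c_def character_diff_right mult.commute)
    also have "(\<Sum>n\<in>?B. character n (\<theta> - x)) = - (\<Sum>n\<in>?B. c n * character n \<theta>)"
      unfolding sum_negf[symmetric] by (intro sum.cong refl) (simp add: c_def character_diff_right mult.commute)
    also have "(\<Sum>n\<in>?A. c n * character n \<theta>) - - (\<Sum>n\<in>?B. c n * character n \<theta>)
        = (\<Sum>n\<in>?A. c n * character n \<theta>) + (\<Sum>n\<in>?B. c n * character n \<theta>)" by simp
    also have "\<dots> = (\<Sum>n\<in>?A \<union> ?B. c n * character n \<theta>)"
      using fin by (subst sum.union_disjoint) auto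
    finally show ?thesis .
  qed
  then have "(\<integral>\<theta>. (cmod (character (axis i 1) (\<theta> - x) - 1))\<^sup>2 * (cmod (dirichlet_kernel F x \<theta>))\<^sup>2 \<partial>torus)
      = (\<integral>\<theta>. (cmod (\<Sum>n\<in>?A \<union> ?B. c n * character n \<theta>))\<^sup>2 \<partial>torus)"
    by (simp flip: power_mult_distrib norm_mult)
  also have "\<dots> = (\<Sum>n\<in>?A \<union> ?B. (cmod (c n))\<^sup>2)"
    using fin by (intro parseval_finite) auto
  also have "\<dots> = card (?A \<union> ?B)"
    by (simp add: c_def if_distrib cong: if_cong)
  also have "\<dots> \<le> real (card ?A) + real (card ?B)"
    using card_Un_le[of ?A ?B] by linarith
  also have "\<dots> \<le> 2 * e * card F"
    using folner_card[OF assms, of i] by simp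
  finally show ?thesis .
qed


lemma reduce_to_cube: "\<exists>k. x + lat k \<in> cbox 0 (1::real^'d)"
proof -
  obtain k0 where "x - lat k0 \<in> half_open_cube" using lat_tile[of x] by blast
  then have "x + lat (- k0) \<in> cbox 0 1"
    by (auto simp: lat_minus half_open_cube_def mem_box_cart less_imp_le)
  then show ?thesis by blast
qed

lemma periodic_bounded:
  assumes "continuous_on UNIV V" "torus_periodic V"
  shows "\<exists>B\<ge>0. \<forall>x. cmod (V x) \<le> B"
proof -
  have "compact (V ` cbox 0 1)"
    by (intro compact_continuous_image compact_cbox continuous_on_subset[OF assms(1)]) simp
  then have "bounded (V ` cbox 0 1)" by (rule compact_imp_bounded)
  then obtain B where B: "\<And>x. x \<in> cbox 0 1 \<Longrightarrow> cmod (V x) \<le> B"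
    unfolding bounded_iff by blast
  have "cmod (V x) \<le> \<bar>B\<bar>" for x
  proof -
    obtain k where "x + lat k \<in> cbox 0 1" using reduce_to_cube by blast
    from B[OF this] have "cmod (V x) \<le> B" using assms(2) by (simp add: torus_periodic_def)
    then show ?thesis by simp
  qed
  then show ?thesis by (intro exI[of _ "\<bar>B\<bar>"]) simp
qed

lemma character_axis_eq_1_iff: "character (axis i 1) y = 1 \<longleftrightarrow> y $ i \<in> \<int>"
proof -
  have "lat (axis i 1) \<bullet> y = y $ i"
  proof -
    have "lat (axis i 1) = axis i (1::real)" by (auto simp: lat_def axis_def vec_eq_iff)
    then show ?thesis by (simp add: inner_axis')
  qed
  then have "character (axis i 1) y = cis (2 * pi * y $ i)" by (simp add: character_def)
  moreover have "cis (2 * pi * t) = 1 \<longleftrightarrow> t \<in> \<int>" for t :: real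
  proof
    assume "cis (2 * pi * t) = 1"
    then have "cos (2 * pi * t) = 1" by (metis cis.sel(1) one_complex.sel(1))
    then obtain n :: int where "2 * pi * t = n * 2 * pi" by (auto simp: cos_one_2pi_int)
    then have "t = n" by simp
    then show "t \<in> \<int>" by simp
  next
    assume "t \<in> \<int>"
    then show "cis (2 * pi * t) = 1" by (rule cis_multiple_2pi)
  qed
  ultimately show ?thesis by simp
qed

lemma lattice_point_if_characters_eq_1:
  assumes "\<And>i. character (axis i 1) y = 1"
  shows "\<exists>k. y = lat k"
proof -
  have "y $ i = of_int \<lfloor>y $ i\<rfloor>" for i
    using assms[of i] unfolding character_axis_eq_1_iff by (simp add: frac_eq_0_iff[symmetric] frac_def)
  then show ?thesis by (intro exI[of _ "\<chi> i. \<lfloor>y $ i\<rfloor>"]) (simp add: lat_def vec_eq_iff)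
qed

text \<open>This expresses continuity at \<open>x\<close> in terms that integrate well against the squared Dirichlet kernel. Where
  \<open>V \<theta>\<close> is not close to \<open>V x\<close>, the sum on the right is bounded away from \<open>0\<close> by compactness, because it vanishes only
  at points congruent to \<open>x\<close>.\<close>

lemma periodic_continuity_by_characters:
  assumes cont: "continuous_on UNIV V" and per: "torus_periodic V" and "e > 0"
  shows "\<exists>K\<ge>0. \<forall>\<theta>. (cmod (V \<theta> - V x))\<^sup>2 \<le> e + K * (\<Sum>i\<in>UNIV. (cmod (character (axis i 1) (\<theta> - x) - 1))\<^sup>2)"
proof -
  define s where "s \<theta> = (\<Sum>i\<in>UNIV. (cmod (character (axis i 1) (\<theta> - x) - 1))\<^sup>2)" for \<theta>
  have s_nonneg: "s \<theta> \<ge> 0" for \<theta> unfolding s_def by (intro sum_nonneg) simp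
  have s_per: "s (\<theta> + lat k) = s \<theta>" for \<theta> k
    unfolding s_def by (simp add: add_diff_eq[symmetric] character_add_right character_diff_right)
  define S where "S = {\<theta> \<in> cbox 0 1. (cmod (V \<theta> - V x))\<^sup>2 \<ge> e}"
  have "closed {\<theta>. (cmod (V \<theta> - V x))\<^sup>2 \<ge> e}"
    by (intro closed_Collect_le continuous_intros cont)
  then have comp: "compact S" unfolding S_def
    using compact_Int_closed[OF compact_cbox] by (simp add: Collect_conj_eq)
  have s_cont: "continuous_on S s"
    unfolding s_def[abs_def] character_def by (intro continuous_intros)
  have s_pos: "s \<theta> > 0" if "\<theta> \<in> S" for \<theta>
  proof (rule ccontr)
    assume "\<not> 0 < s \<theta>"
    with s_nonneg[of \<theta>] have "s \<theta> = 0" by simp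
    then have "\<And>i. character (axis i 1) (\<theta> - x) = 1"
      unfolding s_def by (simp add: sum_nonneg_eq_0_iff)
    from lattice_point_if_characters_eq_1[OF this] obtain k where "\<theta> - x = lat k" by blast
    then have "\<theta> = x + lat k" by (simp add: algebra_simps)
    then have "V \<theta> = V x" using per by (simp add: torus_periodic_def)
    with that \<open>e > 0\<close> show False by (simp add: S_def)
  qed
  obtain s0 where s0: "s0 > 0" "\<And>\<theta>. \<theta> \<in> S \<Longrightarrow> s0 \<le> s \<theta>"
  proof (cases "S = {}")
    case True then show ?thesis using that[of 1] by simp
  next
    case False
    then obtain t where "t \<in> S" "\<And>\<theta>. \<theta> \<in> S \<Longrightarrow> s t \<le> s \<theta>"
      using continuous_attains_inf[OF comp False s_cont] by blast
    then show ?thesis using that[of "s t"] s_pos by blast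
  qed
  obtain B where B: "B \<ge> 0" "\<And>x. cmod (V x) \<le> B" using periodic_bounded[OF cont per] by blast
  let ?K = "(2 * B)\<^sup>2 / s0"
  have main: "(cmod (V \<theta> - V x))\<^sup>2 \<le> e + ?K * s \<theta>" if "\<theta> \<in> cbox 0 1" for \<theta>
  proof (cases "\<theta> \<in> S")
    case True
    have "cmod (V \<theta> - V x) \<le> 2 * B"
      using B(2)[of \<theta>] B(2)[of x] norm_triangle_ineq4[of "V \<theta>" "V x"] by linarith
    then have "(cmod (V \<theta> - V x))\<^sup>2 \<le> (2 * B)\<^sup>2" by (intro power_mono) auto
    also have "\<dots> = ?K * s0" using s0 by simp
    also have "\<dots> \<le> ?K * s \<theta>" using s0 True by (intro mult_left_mono) auto
    finally show ?thesis using \<open>e > 0\<close> by simp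
  next
    case False
    then have "(cmod (V \<theta> - V x))\<^sup>2 \<le> e" using that by (auto simp: S_def)
    moreover have "0 \<le> ?K * s \<theta>" using s0 s_nonneg by simp
    ultimately show ?thesis by linarith
  qed
  have "(cmod (V \<theta> - V x))\<^sup>2 \<le> e + ?K * s \<theta>" for \<theta>
  proof -
    obtain k where "\<theta> + lat k \<in> cbox 0 1" using reduce_to_cube by blast
    from main[OF this] show ?thesis using per by (simp add: s_per torus_periodic_def)
  qed
  then show ?thesis using s0 unfolding s_def by (intro exI[of _ ?K]) auto
qed

lemma fourier_coeff_torus:
  assumes "continuous_on UNIV V"
  shows "fourier_coeff V k = (\<integral>\<theta>. V \<theta> * cnj (character k \<theta>) \<partial>torus)"
proof -
  have [measurable]: "V \<in> borel_measurable borel" using assms by (rule borel_measurable_continuous_onI)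
  have "fourier_coeff V k = (LINT \<theta>:cbox 0 1|lborel. V \<theta> * cnj (character k \<theta>))"
    by (simp add: fourier_coeff_def character_def cis_cnj)
  also have "\<dots> = (\<integral>\<theta>. V \<theta> * cnj (character k \<theta>) \<partial>torus)"
    by (rule LINT_cube_eq_torus) measurable
  finally show ?thesis .
qed

text \<open>The sum over \<open>n\<close> is the adjoint of the convolution with the Fourier coefficients of \<open>V\<close>, applied to a wave. The
  difference to \<open>cnj (V x)\<close> times the wave consists of the Fourier coefficients of
  \<open>cnj (V \<theta> - V x)\<close> times the Dirichlet kernel at \<open>x\<close>. By Bessel's inequality its norm is at most the \<open>L\<^sup>2\<close> norm of that
  product, which is small since the kernel is concentrated where \<open>V\<close> is close to \<open>V x\<close>.\<close>

lemma wave_almost_eigen: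
  fixes \<eta> :: real
  assumes cont: "continuous_on UNIV V" and per: "torus_periodic V" and "\<eta> > 0"
  shows "\<exists>e>0. \<forall>F. folner e F \<longrightarrow> (\<forall>S. finite S \<longrightarrow>
     (\<Sum>m\<in>S. (cmod ((\<Sum>n\<in>F. wave F x n * cnj (fourier_coeff V (n - m))) - cnj (V x) * wave F x m))\<^sup>2) \<le> \<eta> * card F)"
proof -
  obtain K where K: "K \<ge> 0" "\<And>\<theta>. (cmod (V \<theta> - V x))\<^sup>2 \<le> \<eta>/2 + K * (\<Sum>i\<in>UNIV. (cmod (character (axis i 1) (\<theta> - x) - 1))\<^sup>2)"
    using periodic_continuity_by_characters[OF cont per, of "\<eta>/2" x] \<open>\<eta> > 0\<close> by auto
  obtain B where B: "B \<ge> 0" "\<And>x. cmod (V x) \<le> B" using periodic_bounded[OF cont per] by blast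
  have [measurable]: "V \<in> borel_measurable borel" using cont by (rule borel_measurable_continuous_onI)
  let ?d = "real CARD('a)"
  \<comment> \<open>summed over the \<open>?d\<close> directions, the boundary terms then amount to at most \<open>\<eta> / 2\<close>; the \<open>1\<close> covers \<open>K = 0\<close>\<close>
  define e where "e = \<eta> / (4 * (K * ?d + 1))"
  have "e > 0" using K \<open>\<eta> > 0\<close> by (auto simp: e_def intro!: divide_pos_pos mult_pos_pos add_nonneg_pos)
  have Ke: "K * ?d * (2 * e) \<le> \<eta> / 2"
  proof -
    have "K * ?d * (2 * e) \<le> (K * ?d + 1) * (2 * e)" using \<open>e > 0\<close> by (intro mult_right_mono) auto
    also have "\<dots> = \<eta> / 2"
    proof -
      have "K * ?d + 1 > 0" using K by (intro add_nonneg_pos) auto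
      then show ?thesis unfolding e_def by (simp add: field_simps)
    qed
    finally show ?thesis .
  qed
  have cf: "cnj (fourier_coeff V k) = (\<integral>\<theta>. cnj (V \<theta>) * character k \<theta> \<partial>torus)" for k
    using Bochner_Integration.integral_cnj[of torus "\<lambda>\<theta>. V \<theta> * cnj (character k \<theta>)"] by (simp add: fourier_coeff_torus[OF cont])
  show ?thesis
  proof (intro exI[of _ e] conjI allI impI \<open>e > 0\<close>)
    fix F :: "(int^'a) set" and S :: "(int^'a) set" assume F: "folner e F" and S: "finite S"
    have fin: "finite F" using F by (simp add: folner_def)
    define h where "h \<theta> = cnj (V \<theta> - V x) * dirichlet_kernel F x \<theta>" for \<theta>
    have hm [measurable]: "h \<in> borel_measurable borel" unfolding h_def[abs_def] by measurable
    have hB: "cmod (h \<theta>) \<le> (2 * B) * card F" for \<theta>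
    proof -
      have "cmod (V \<theta> - V x) \<le> 2 * B"
        using B(2)[of \<theta>] B(2)[of x] norm_triangle_ineq4[of "V \<theta>" "V x"] by linarith
      then show ?thesis unfolding h_def norm_mult complex_mod_cnj
        using B cmod_dirichlet_kernel_le[of F x \<theta>] by (intro mult_mono) auto
    qed
    have coeff: "(\<Sum>n\<in>F. wave F x n * cnj (fourier_coeff V (n - m))) - cnj (V x) * wave F x m
        = (\<integral>\<theta>. h \<theta> * cnj (character m \<theta>) \<partial>torus)" for m
    proof -
      have i1: "integrable torus (\<lambda>\<theta>. wave F x n * (cnj (V \<theta>) * character (n - m) \<theta>))" for n
        using B by (intro integrable_mult_right integrable_torus_bounded[where B=B]) (auto simp: norm_mult)
      have i2: "integrable torus (\<lambda>\<theta>. cnj (V x) * (dirichlet_kernel F x \<theta> * cnj (character m \<theta>)))"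
        using cmod_dirichlet_kernel_le[of F x]
        by (intro integrable_mult_right integrable_torus_bounded[where B="card F"]) (auto simp: norm_mult)
      have "(\<Sum>n\<in>F. wave F x n * cnj (fourier_coeff V (n - m))) = (\<Sum>n\<in>F. (\<integral>\<theta>. wave F x n * (cnj (V \<theta>) * character (n - m) \<theta>) \<partial>torus))"
        by (simp add: cf)
      also have "\<dots> = (\<integral>\<theta>. (\<Sum>n\<in>F. wave F x n * (cnj (V \<theta>) * character (n - m) \<theta>)) \<partial>torus)"
        by (rule Bochner_Integration.integral_sum[symmetric]) (rule i1)
      finally have "(\<Sum>n\<in>F. wave F x n * cnj (fourier_coeff V (n - m))) - cnj (V x) * wave F x m
         = (\<integral>\<theta>. (\<Sum>n\<in>F. wave F x n * (cnj (V \<theta>) * character (n - m) \<theta>)) \<partial>torus)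
          - (\<integral>\<theta>. cnj (V x) * (dirichlet_kernel F x \<theta> * cnj (character m \<theta>)) \<partial>torus)"
        by (simp add: dirichlet_kernel_coeff[OF fin])
      also have "\<dots> = (\<integral>\<theta>. (\<Sum>n\<in>F. wave F x n * (cnj (V \<theta>) * character (n - m) \<theta>))
            - cnj (V x) * (dirichlet_kernel F x \<theta> * cnj (character m \<theta>)) \<partial>torus)"
        by (rule Bochner_Integration.integral_diff[symmetric]) (intro Bochner_Integration.integrable_sum i1, rule i2)
      also have "\<dots> = (\<integral>\<theta>. h \<theta> * cnj (character m \<theta>) \<partial>torus)"
      proof (intro Bochner_Integration.integral_cong refl)
        fix \<theta>
        have "(\<Sum>n\<in>F. wave F x n * (cnj (V \<theta>) * character (n - m) \<theta>)) = cnj (V \<theta>) * (dirichlet_kernel F x \<theta> * cnj (character m \<theta>))"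
          unfolding dirichlet_kernel_def sum_distrib_left sum_distrib_right character_diff by (simp add: mult_ac)
        then show "(\<Sum>n\<in>F. wave F x n * (cnj (V \<theta>) * character (n - m) \<theta>))
            - cnj (V x) * (dirichlet_kernel F x \<theta> * cnj (character m \<theta>)) = h \<theta> * cnj (character m \<theta>)"
          by (simp add: h_def algebra_simps)
      qed
      finally show ?thesis .
    qed
    have i1: "integrable torus (\<lambda>\<theta>. (cmod (dirichlet_kernel F x \<theta>))\<^sup>2)"
      using cmod_dirichlet_kernel_le[of F x]
      by (intro integrable_torus_bounded[where B="(real (card F))\<^sup>2"]) (auto intro!: power_mono)
    have i2: "integrable torus (\<lambda>\<theta>. (cmod (character (axis i 1) (\<theta> - x) - 1))\<^sup>2 * (cmod (dirichlet_kernel F x \<theta>))\<^sup>2)" for i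
    proof (intro integrable_torus_bounded[where B="2\<^sup>2 * (real (card F))\<^sup>2"])
      fix \<theta>
      have "cmod (character (axis i 1) (\<theta> - x) - 1) \<le> 2"
        using norm_triangle_ineq4[of "character (axis i 1) (\<theta> - x)" 1] by simp
      then show "norm ((cmod (character (axis i 1) (\<theta> - x) - 1))\<^sup>2 * (cmod (dirichlet_kernel F x \<theta>))\<^sup>2) \<le> 2\<^sup>2 * (real (card F))\<^sup>2"
        unfolding norm_mult norm_power using cmod_dirichlet_kernel_le[of F x \<theta>] by (intro mult_mono power_mono) auto
    qed measurable
    have "(\<Sum>m\<in>S. (cmod (\<integral>\<theta>. h \<theta> * cnj (character m \<theta>) \<partial>torus))\<^sup>2) \<le> (\<integral>\<theta>. (cmod (h \<theta>))\<^sup>2 \<partial>torus)"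
      by (rule bessel[OF hm hB S])
    also have "\<dots> \<le> (\<integral>\<theta>. \<eta>/2 * (cmod (dirichlet_kernel F x \<theta>))\<^sup>2
        + K * (\<Sum>i\<in>UNIV. (cmod (character (axis i 1) (\<theta> - x) - 1))\<^sup>2 * (cmod (dirichlet_kernel F x \<theta>))\<^sup>2) \<partial>torus)"
    proof (rule integral_mono)
      show "integrable torus (\<lambda>\<theta>. (cmod (h \<theta>))\<^sup>2)"
        using hB by (intro integrable_torus_bounded[where B="((2 * B) * card F)\<^sup>2"]) (auto intro!: power_mono)
      show "integrable torus (\<lambda>\<theta>. \<eta>/2 * (cmod (dirichlet_kernel F x \<theta>))\<^sup>2
        + K * (\<Sum>i\<in>UNIV. (cmod (character (axis i 1) (\<theta> - x) - 1))\<^sup>2 * (cmod (dirichlet_kernel F x \<theta>))\<^sup>2))"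
        using i1 i2 by (intro Bochner_Integration.integrable_add integrable_mult_right Bochner_Integration.integrable_sum)
      fix \<theta>
      have "(cmod (h \<theta>))\<^sup>2 = (cmod (V \<theta> - V x))\<^sup>2 * (cmod (dirichlet_kernel F x \<theta>))\<^sup>2"
        by (simp add: h_def norm_mult power_mult_distrib flip: complex_cnj_diff)
      also have "\<dots> \<le> (\<eta>/2 + K * (\<Sum>i\<in>UNIV. (cmod (character (axis i 1) (\<theta> - x) - 1))\<^sup>2)) * (cmod (dirichlet_kernel F x \<theta>))\<^sup>2"
        by (intro mult_right_mono K) simp
      finally show "(cmod (h \<theta>))\<^sup>2 \<le> \<eta>/2 * (cmod (dirichlet_kernel F x \<theta>))\<^sup>2
        + K * (\<Sum>i\<in>UNIV. (cmod (character (axis i 1) (\<theta> - x) - 1))\<^sup>2 * (cmod (dirichlet_kernel F x \<theta>))\<^sup>2)"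
        by (simp add: distrib_right sum_distrib_right mult.assoc)
    qed
    also have "\<dots> = \<eta>/2 * card F + K * (\<Sum>i\<in>UNIV. (\<integral>\<theta>. (cmod (character (axis i 1) (\<theta> - x) - 1))\<^sup>2 * (cmod (dirichlet_kernel F x \<theta>))\<^sup>2 \<partial>torus))"
      using i1 i2 dirichlet_kernel_L2[OF fin, of x] by (simp add: Bochner_Integration.integral_sum)
    also have "\<dots> \<le> \<eta>/2 * card F + K * (\<Sum>i::'a\<in>UNIV. 2 * e * card F)"
      using K by (intro add_left_mono mult_left_mono sum_mono dirichlet_kernel_concentrated F)
    also have "\<dots> = \<eta>/2 * card F + (K * ?d * (2 * e)) * card F" by simp
    also have "\<dots> \<le> \<eta>/2 * card F + \<eta>/2 * card F"
      by (intro add_left_mono mult_right_mono Ke) simp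
    finally show "(\<Sum>m\<in>S. (cmod ((\<Sum>n\<in>F. wave F x n * cnj (fourier_coeff V (n - m))) - cnj (V x) * wave F x m))\<^sup>2) \<le> \<eta> * card F"
      by (simp add: coeff)
  qed
qed

section \<open>The adjoint off the spectrum\<close>

text \<open>The statement \<open>\<parallel>g\<parallel> \<le> b\<close>, with square summability included. Finite partial sums avoid separate proofs of membership
  in \<open>ell2\<close>.\<close>

definition l2_bounded :: "('a \<Rightarrow> complex) \<Rightarrow> real \<Rightarrow> bool" where
  "l2_bounded g b \<longleftrightarrow> (\<forall>S. finite S \<longrightarrow> L2_set (\<lambda>n. cmod (g n)) S \<le> b)"

lemma l2_bounded_nonneg: "l2_bounded g b \<Longrightarrow> b \<ge> 0"
  unfolding l2_bounded_def by (metis L2_set_empty finite.emptyI)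

lemma l2_bounded_mono: "l2_bounded g b \<Longrightarrow> b \<le> b' \<Longrightarrow> l2_bounded g b'"
  unfolding l2_bounded_def by force

lemma l2_bounded_add:
  assumes "l2_bounded g b" "l2_bounded h c"
  shows "l2_bounded (\<lambda>n. g n + h n) (b + c)"
  unfolding l2_bounded_def
proof (intro allI impI)
  fix S :: "'a set" assume S: "finite S"
  have "L2_set (\<lambda>n. cmod (g n + h n)) S \<le> L2_set (\<lambda>n. cmod (g n) + cmod (h n)) S"
    by (intro L2_set_mono norm_triangle_ineq) auto
  also have "\<dots> \<le> L2_set (\<lambda>n. cmod (g n)) S + L2_set (\<lambda>n. cmod (h n)) S"
    by (rule L2_set_triangle_ineq)
  also have "\<dots> \<le> b + c"
    using assms S unfolding l2_bounded_def by (intro add_mono) auto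
  finally show "L2_set (\<lambda>n. cmod (g n + h n)) S \<le> b + c" .
qed

lemma l2_bounded_scale:
  assumes "l2_bounded g b"
  shows "l2_bounded (\<lambda>n. c * g n) (cmod c * b)"
  using assms unfolding l2_bounded_def norm_mult
  by (simp add: mult_left_mono flip: L2_set_right_distrib)

lemma l2_bounded_sum:
  assumes "finite J" "\<And>j. j \<in> J \<Longrightarrow> l2_bounded (g j) (b j)"
  shows "l2_bounded (\<lambda>n. \<Sum>j\<in>J. g j n) (\<Sum>j\<in>J. b j)"
  using assms
proof (induction J rule: finite_induct)
  case empty
  then show ?case by (simp add: l2_bounded_def L2_set_def)
next
  case (insert j J)
  then show ?case by (simp add: l2_bounded_add)
qed

lemma l2_bounded_finite_support:
  assumes "finite F" "\<And>n. n \<notin> F \<Longrightarrow> f n = 0"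
  shows "l2_bounded f (L2_set (\<lambda>n. cmod (f n)) F)"
  unfolding l2_bounded_def
proof (intro allI impI)
  fix S :: "'a set" assume "finite S"
  have "(\<Sum>n\<in>S. (cmod (f n))\<^sup>2) = (\<Sum>n\<in>S \<inter> F. (cmod (f n))\<^sup>2)"
    using assms \<open>finite S\<close> by (intro sum.mono_neutral_right) auto
  also have "\<dots> \<le> (\<Sum>n\<in>F. (cmod (f n))\<^sup>2)"
    using assms by (intro sum_mono2) auto
  finally show "L2_set (\<lambda>n. cmod (f n)) S \<le> L2_set (\<lambda>n. cmod (f n)) F"
    unfolding L2_set_def by simp
qed

lemma ell2_l2_bounded:
  assumes "u \<in> ell2"
  shows "l2_bounded u (ell2_norm u)"
  unfolding l2_bounded_def ell2_norm_def L2_set_def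
  using assms by (auto simp: ell2_def intro!: finite_sum_le_infsum)

lemma finite_support_ell2:
  assumes "finite F" "\<And>n. n \<notin> F \<Longrightarrow> f n = 0"
  shows "f \<in> ell2" "ell2_norm f = L2_set (\<lambda>n. cmod (f n)) F"
proof -
  have *: "((\<lambda>n. (cmod (f n))\<^sup>2) has_sum (\<Sum>n\<in>F. (cmod (f n))\<^sup>2)) UNIV"
    using assms by (intro has_sum_finite_neutralI) auto
  then show "f \<in> ell2" unfolding ell2_def by (auto simp: summable_on_def)
  show "ell2_norm f = L2_set (\<lambda>n. cmod (f n)) F"
    using infsumI[OF *] by (simp add: ell2_norm_def L2_set_def)
qed

lemma l2_pairing_bound:
  assumes "l2_bounded u a" "l2_bounded w b" "((\<lambda>n. cnj (w n) * u n) has_sum s) UNIV"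
  shows "cmod s \<le> a * b"
proof -
  have fin: "cmod (\<Sum>n\<in>S. cnj (w n) * u n) \<le> a * b" if "finite S" for S
  proof -
    have "cmod (\<Sum>n\<in>S. cnj (w n) * u n) \<le> (\<Sum>n\<in>S. \<bar>cmod (u n)\<bar> * \<bar>cmod (w n)\<bar>)"
      by (rule order_trans[OF norm_sum]) (simp add: norm_mult mult.commute)
    also have "\<dots> \<le> L2_set (\<lambda>n. cmod (u n)) S * L2_set (\<lambda>n. cmod (w n)) S"
      by (rule L2_set_mult_ineq)
    also have "\<dots> \<le> a * b"
      using assms that l2_bounded_nonneg[OF assms(1)] unfolding l2_bounded_def by (intro mult_mono) auto
    finally show ?thesis .
  qed
  have "((\<lambda>S. cmod (\<Sum>n\<in>S. cnj (w n) * u n)) \<longlongrightarrow> cmod s) (finite_subsets_at_top UNIV)"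
    using assms(3) unfolding has_sum_def by (rule tendsto_norm)
  then show ?thesis
    by (rule tendsto_upperbound) (auto intro!: eventually_finite_subsets_at_top_weakI fin)
qed

lemma ell2_product_summable:
  assumes "v \<in> ell2" "u \<in> ell2"
  shows "(\<lambda>n. v n * u n) summable_on UNIV"
proof -
  have "(\<lambda>n. (cmod (v n))\<^sup>2 + (cmod (u n))\<^sup>2) summable_on UNIV"
    using assms unfolding ell2_def by (auto intro!: summable_on_add)
  moreover have "norm (v n * u n) \<le> (cmod (v n))\<^sup>2 + (cmod (u n))\<^sup>2" for n
  proof -
    have "2 * (cmod (v n) * cmod (u n)) \<le> (cmod (v n))\<^sup>2 + (cmod (u n))\<^sup>2"
      using sum_squares_bound[of "cmod (v n)" "cmod (u n)"] by simp
    moreover have "0 \<le> cmod (v n) * cmod (u n)" by simp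
    ultimately show ?thesis
      unfolding norm_mult by linarith
  qed
  ultimately have "(\<lambda>n. norm (v n * u n)) summable_on UNIV"
    by (rule Infinite_Sum.abs_summable_on_comparison_test')
  then show ?thesis by (rule abs_summable_summable)
qed

lemma fourier_coeff_ell2:
  assumes cont: "continuous_on UNIV V" and per: "torus_periodic V"
  shows "fourier_coeff V \<in> ell2"
proof -
  obtain B where B: "\<And>x. cmod (V x) \<le> B" using periodic_bounded[OF cont per] by blast
  have "(\<Sum>n\<in>S. (cmod (fourier_coeff V n))\<^sup>2) \<le> (\<integral>x. (cmod (V x))\<^sup>2 \<partial>torus)" if "finite S" for S
    unfolding fourier_coeff_torus[OF cont]
    by (rule bessel[OF borel_measurable_continuous_onI[OF cont] B that])
  then show ?thesis unfolding ell2_def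
    by (auto intro!: nonneg_bdd_above_summable_on bdd_aboveI2)
qed

lemma ell2_reflect:
  fixes v :: "int^'d \<Rightarrow> complex"
  assumes "v \<in> ell2"
  shows "(\<lambda>m. v (n - m)) \<in> ell2"
proof -
  have "bij_betw (\<lambda>m. n - m) UNIV UNIV"
    by (rule bij_betw_byWitness[where f'="\<lambda>m. n - m"]) auto
  from summable_on_reindex_bij_betw[OF this, of "\<lambda>m. (cmod (v m))\<^sup>2"] show ?thesis
    using assms by (simp add: ell2_def)
qed

text \<open>The Hilbert space adjoint of \<open>H - z\<close> at a vector \<open>f\<close> supported in \<open>F\<close>; here \<open>l\<close> stands for \<open>lam * cis (2 * pi * \<omega>)\<close>.\<close>

definition dual_op :: "(real^'d \<Rightarrow> complex) \<Rightarrow> real^'d \<Rightarrow> complex \<Rightarrow> complex \<Rightarrow>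
    (int^'d) set \<Rightarrow> (int^'d \<Rightarrow> complex) \<Rightarrow> int^'d \<Rightarrow> complex" where
  "dual_op V \<alpha> l z F f m = (\<Sum>n\<in>F. f n * cnj (fourier_coeff V (n - m)))
      + (cnj l * cnj (character m \<alpha>) - cnj z) * f m"

lemma has_sum_sum_finite:
  fixes f :: "'i \<Rightarrow> 'a \<Rightarrow> complex"
  assumes "finite I" "\<And>i. i \<in> I \<Longrightarrow> (f i has_sum s i) A"
  shows "((\<lambda>x. \<Sum>i\<in>I. f i x) has_sum (\<Sum>i\<in>I. s i)) A"
  using assms by (induction I rule: finite_induct) (auto intro: has_sum_add)

text \<open>The adjoint relation between \<open>H - z\<close> and \<open>dual_op\<close>. As \<open>f\<close> is finitely supported, only a finite sum is interchanged
  with infinite ones, and these converge by \<open>ell2_product_summable\<close>.\<close>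

lemma H_dual_pairing:
  assumes cont: "continuous_on UNIV V" and per: "torus_periodic V"
    and F: "finite F" "\<And>n. n \<notin> F \<Longrightarrow> f n = 0" and u: "u \<in> ell2"
  shows "((\<lambda>m. cnj (dual_op V \<alpha> (lam * cis (2 * pi * \<omega>)) z F f m) * u m) has_sum
     (\<Sum>n\<in>F. cnj (f n) * (H V \<alpha> lam \<omega> u n - z * u n))) UNIV"
proof -
  let ?v = "fourier_coeff V" and ?l = "lam * cis (2 * pi * \<omega>)"
  have conv: "((\<lambda>m. ?v (n - m) * u m) has_sum (\<Sum>\<^sub>\<infinity>k. ?v k * u (n - k))) UNIV" for n
  proof -
    have "bij_betw (\<lambda>m. n - m) UNIV UNIV"
      by (rule bij_betw_byWitness[where f'="\<lambda>m. n - m"]) auto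
    from infsum_reindex_bij_betw[OF this, of "\<lambda>k. ?v k * u (n - k)"]
    have "(\<Sum>\<^sub>\<infinity>m. ?v (n - m) * u m) = (\<Sum>\<^sub>\<infinity>k. ?v k * u (n - k))" by simp
    then show ?thesis
      using has_sum_infsum[OF ell2_product_summable[OF ell2_reflect[OF fourier_coeff_ell2[OF cont per], of n] u]]
      by simp
  qed
  have "((\<lambda>m. \<Sum>n\<in>F. cnj (f n) * (?v (n - m) * u m)) has_sum
      (\<Sum>n\<in>F. cnj (f n) * (\<Sum>\<^sub>\<infinity>k. ?v k * u (n - k)))) UNIV"
    by (intro has_sum_sum_finite F has_sum_cmult_right conv)
  moreover have "((\<lambda>m. (?l * character m \<alpha> - z) * cnj (f m) * u m) has_sum
      (\<Sum>n\<in>F. (?l * character n \<alpha> - z) * cnj (f n) * u n)) UNIV"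
    using F by (intro has_sum_finite_neutralI) auto
  ultimately have "((\<lambda>m. (\<Sum>n\<in>F. cnj (f n) * (?v (n - m) * u m)) + (?l * character m \<alpha> - z) * cnj (f m) * u m) has_sum
      ((\<Sum>n\<in>F. cnj (f n) * (\<Sum>\<^sub>\<infinity>k. ?v k * u (n - k))) + (\<Sum>n\<in>F. (?l * character n \<alpha> - z) * cnj (f n) * u n))) UNIV"
    by (rule has_sum_add)
  also have "(\<lambda>m. (\<Sum>n\<in>F. cnj (f n) * (?v (n - m) * u m)) + (?l * character m \<alpha> - z) * cnj (f m) * u m)
      = (\<lambda>m. cnj (dual_op V \<alpha> ?l z F f m) * u m)"
    by (simp add: dual_op_def fun_eq_iff distrib_right sum_distrib_right mult.assoc)
  also have "(\<Sum>n\<in>F. cnj (f n) * (\<Sum>\<^sub>\<infinity>k. ?v k * u (n - k))) + (\<Sum>n\<in>F. (?l * character n \<alpha> - z) * cnj (f n) * u n)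
      = (\<Sum>n\<in>F. cnj (f n) * (H V \<alpha> lam \<omega> u n - z * u n))"
    unfolding sum.distrib[symmetric]
  proof (intro sum.cong refl)
    fix n
    have p: "lam * cis (2 * pi * (\<omega> + lat n \<bullet> \<alpha>)) = ?l * character n \<alpha>"
      by (simp add: character_def cis_mult algebra_simps)
    show "cnj (f n) * (\<Sum>\<^sub>\<infinity>k. ?v k * u (n - k)) + (?l * character n \<alpha> - z) * cnj (f n) * u n
        = cnj (f n) * (H V \<alpha> lam \<omega> u n - z * u n)"
      unfolding H_def p by (simp add: algebra_simps)
  qed
  finally show ?thesis .
qed

definition dual_lower_bound :: "(real^'d \<Rightarrow> complex) \<Rightarrow> real^'d \<Rightarrow> complex \<Rightarrow> complex \<Rightarrow> real \<Rightarrow> bool" where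
  "dual_lower_bound V \<alpha> l z C \<longleftrightarrow> (\<forall>F f b. finite F \<longrightarrow> (\<forall>n. n \<notin> F \<longrightarrow> f n = 0) \<longrightarrow>
     l2_bounded (dual_op V \<alpha> l z F f) b \<longrightarrow> L2_set (\<lambda>n. cmod (f n)) F \<le> C * b)"

text \<open>If \<open>R\<close> is the inverse of \<open>H - z\<close>, then \<open>\<parallel>f\<parallel>\<^sup>2\<close> is the inner product of \<open>f\<close> with \<open>(H - z) (R f)\<close>, hence of
  \<open>(H - z)\<^sup>* f\<close> with \<open>R f\<close>, and \<open>\<parallel>R f\<parallel> \<le> C \<parallel>f\<parallel>\<close>.\<close>

lemma resolvent_dual_lower_bound:
  assumes cont: "continuous_on UNIV V" and per: "torus_periodic V"
    and z: "z \<notin> ell2_spectrum (H V \<alpha> lam \<omega>)"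
  shows "\<exists>C\<ge>0. dual_lower_bound V \<alpha> (lam * cis (2 * pi * \<omega>)) z C"
proof -
  obtain R where R: "bounded_op R" and inv: "\<And>u. u \<in> ell2 \<Longrightarrow> (\<lambda>n. H V \<alpha> lam \<omega> (R u) n - z * R u n) = u"
    using z unfolding ell2_spectrum_def by auto
  from R obtain C0 where C0: "\<And>u. u \<in> ell2 \<Longrightarrow> ell2_norm (R u) \<le> C0 * ell2_norm u"
    and R2: "\<And>u. u \<in> ell2 \<Longrightarrow> R u \<in> ell2"
    unfolding bounded_op_def by blast
  define C where "C = \<bar>C0\<bar>"
  have "dual_lower_bound V \<alpha> (lam * cis (2 * pi * \<omega>)) z C"
    unfolding dual_lower_bound_def
  proof (intro allI impI)
    fix F :: "(int^'a) set" and f b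
    assume F: "finite F" "\<forall>n. n \<notin> F \<longrightarrow> f n = 0"
      and b: "l2_bounded (dual_op V \<alpha> (lam * cis (2 * pi * \<omega>)) z F f) b"
    let ?nf = "L2_set (\<lambda>n. cmod (f n)) F"
    have f2: "f \<in> ell2" and nf: "ell2_norm f = ?nf"
      using finite_support_ell2[of F f] F by auto
    have "ell2_norm (R f) \<le> C0 * ?nf" using C0[OF f2] nf by simp
    also have "\<dots> \<le> C * ?nf" unfolding C_def by (intro mult_right_mono) auto
    finally have Rf: "l2_bounded (R f) (C * ?nf)"
      using ell2_l2_bounded[OF R2[OF f2]] l2_bounded_mono by blast
    have "(\<Sum>n\<in>F. cnj (f n) * (H V \<alpha> lam \<omega> (R f) n - z * R f n)) = (\<Sum>n\<in>F. cnj (f n) * f n)"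
      using fun_cong[OF inv[OF f2]] by simp
    also have "\<dots> = complex_of_real (?nf\<^sup>2)"
      by (simp add: L2_set_def complex_norm_square mult.commute sum_nonneg del: of_real_power)
    finally have "cmod (complex_of_real (?nf\<^sup>2)) \<le> (C * ?nf) * b"
      using l2_pairing_bound[OF Rf b] H_dual_pairing[OF cont per, of F f "R f" \<alpha> lam \<omega> z] F R2[OF f2] by metis
    then have "?nf * ?nf \<le> ?nf * (C * b)"
      unfolding norm_of_real by (simp add: power2_eq_square mult_ac)
    then show "?nf \<le> C * b"
    proof (cases "?nf = 0")
      case True
      then show ?thesis using l2_bounded_nonneg[OF b] by (simp add: C_def)
    next
      case False
      then have "?nf > 0" using L2_set_nonneg[of _ F] by (simp add: order_less_le)
      then show ?thesis using \<open>?nf * ?nf \<le> ?nf * (C * b)\<close> by simp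
    qed
  qed
  then show ?thesis by (intro exI[of _ C]) (simp add: C_def)
qed

text \<open>Changing \<open>z0\<close> to \<open>z\<close> changes \<open>\<parallel>(H - z)\<^sup>* f\<parallel>\<close> by at most \<open>\<bar>z - z0\<bar> \<parallel>f\<parallel>\<close>, which can be absorbed into the left-hand side.\<close>

lemma dual_lower_bound_nearby:
  assumes "dual_lower_bound V \<alpha> l z0 C" "C \<ge> 0" "C * cmod (z - z0) \<le> 1/2"
  shows "dual_lower_bound V \<alpha> l z (2 * C)"
  unfolding dual_lower_bound_def
proof (intro allI impI)
  fix F :: "(int^'a) set" and f b
  assume F: "finite F" "\<forall>n. n \<notin> F \<longrightarrow> f n = 0" and b: "l2_bounded (dual_op V \<alpha> l z F f) b"
  let ?nf = "L2_set (\<lambda>n. cmod (f n)) F"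
  have "l2_bounded (\<lambda>n. dual_op V \<alpha> l z F f n + cnj (z - z0) * f n) (b + cmod (cnj (z - z0)) * ?nf)"
    using F by (intro l2_bounded_add l2_bounded_scale l2_bounded_finite_support b) auto
  also have "(\<lambda>n. dual_op V \<alpha> l z F f n + cnj (z - z0) * f n) = dual_op V \<alpha> l z0 F f"
    by (simp add: dual_op_def fun_eq_iff algebra_simps)
  finally have "?nf \<le> C * (b + cmod (cnj (z - z0)) * ?nf)"
    using assms(1) F unfolding dual_lower_bound_def by blast
  also have "\<dots> = C * b + (C * cmod (z - z0)) * ?nf"
    unfolding complex_mod_cnj by (simp add: algebra_simps)
  also have "\<dots> \<le> C * b + 1/2 * ?nf"
    using assms(3) by (intro add_left_mono mult_right_mono) auto
  finally show "?nf \<le> 2 * C * b" by simp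
qed

section \<open>Rational independence and dense orbits\<close>

lemma rationally_independent_int:
  assumes "rationally_independent \<alpha>" "of_int q0 + (\<Sum>i\<in>UNIV. of_int (q i) * \<alpha> $ i) = 0"
  shows "q0 = 0" "q i = 0"
proof -
  have "of_rat (of_int q0) + (\<Sum>i\<in>UNIV. of_rat (of_int (q i)) * \<alpha> $ i) = 0"
    using assms(2) by simp
  from assms(1)[unfolded rationally_independent_def, THEN spec, THEN spec, THEN mp, OF this]
  show "q0 = 0" "q i = 0" by auto
qed

text \<open>So the points \<open>x + j \<alpha>\<close> are distinct on the torus, and the waves at these points are orthogonal in mean.\<close>

lemma multiple_not_lat:
  assumes "rationally_independent \<alpha>" "k \<noteq> (0::int)"
  shows "of_int k *\<^sub>R \<alpha> \<notin> range lat"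
proof
  assume "of_int k *\<^sub>R \<alpha> \<in> range lat"
  then obtain l where l: "of_int k *\<^sub>R \<alpha> = lat l" by auto
  fix i :: 'a
  have e: "of_int k * \<alpha> $ i = of_int (l $ i)"
    using arg_cong[OF l, of "\<lambda>v. v $ i"] by (simp add: lat_def)
  have "of_int (- l $ i) + (\<Sum>j\<in>UNIV. of_int (if j = i then k else 0) * \<alpha> $ j) = 0"
    using e by (simp add: if_distrib[of of_int] if_distrib[of "\<lambda>t. t * _"] cong: if_cong)
  from rationally_independent_int(2)[OF assms(1) this, of i] assms(2) show False by simp
qed

text \<open>Kronecker's theorem for finite sequences of reals, carried over to vectors indexed by a finite type.\<close>

lemma orbit_approximates:
  fixes \<alpha> \<beta> :: "real^'d"
  assumes indep: "rationally_independent \<alpha>" and "e > 0"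
  obtains k :: int and p :: "int^'d" where "\<And>i. \<bar>of_int k * \<alpha> $ i - of_int (p $ i) - \<beta> $ i\<bar> < e"
proof -
  interpret Z: module "\<lambda>r. (*) (real_of_int r)"
    by (simp add: module.intro distrib_left mult.commute)
  define n where "n = CARD('d)"
  obtain h where h: "bij_betw h {..<n} (UNIV :: 'd set)"
    using ex_bij_betw_nat_finite[of "UNIV :: 'd set"] unfolding n_def lessThan_atLeast0 by auto
  define a where "a i = (if i < n then \<alpha> $ h i else 1)" for i
  have sum_a: "(\<Sum>i\<le>n. of_int (u i) * a i) = of_int (u n) + (\<Sum>j\<in>UNIV. of_int (u (the_inv_into {..<n} h j)) * \<alpha> $ j)" for u :: "nat \<Rightarrow> int"
  proof -
    have "(\<Sum>j\<in>UNIV. of_int (u (the_inv_into {..<n} h j)) * \<alpha> $ j) = (\<Sum>i<n. of_int (u i) * \<alpha> $ h i)"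
      using h by (subst sum.reindex_bij_betw[OF h, symmetric]) (auto simp: bij_betw_def the_inv_into_f_f)
    then show ?thesis
      by (simp add: lessThan_Suc_atMost[symmetric] a_def)
  qed
  have zero: "u i = 0" if "(\<Sum>i\<le>n. of_int (u i) * a i) = 0" "i \<le> n" for u :: "nat \<Rightarrow> int" and i
  proof (cases "i < n")
    case True
    have "u (the_inv_into {..<n} h (h i)) = 0"
      by (rule rationally_independent_int(2)[OF indep that(1)[unfolded sum_a]])
    then show ?thesis using h True by (simp add: bij_betw_def the_inv_into_f_f)
  next
    case False
    then show ?thesis using that rationally_independent_int(1)[OF indep that(1)[unfolded sum_a]] by simp
  qed
  have inj: "inj_on a {..n}"
  proof (rule inj_onI)
    fix i j assume ij: "i \<in> {..n}" "j \<in> {..n}" "a i = a j"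
    show "i = j"
    proof (rule ccontr)
      assume "i \<noteq> j"
      define u :: "nat \<Rightarrow> int" where "u k = (if k = i then 1 else 0) - (if k = j then 1 else 0)" for k
      have "(\<Sum>k\<le>n. of_int (u k) * a k) = (\<Sum>k\<le>n. (if k = i then a k else 0) - (if k = j then a k else 0))"
        by (intro sum.cong) (auto simp: u_def)
      also have "\<dots> = a i - a j" using ij by (simp add: sum_subtractf)
      finally have "u i = 0" using zero[of u i] ij by simp
      with \<open>i \<noteq> j\<close> show False by (simp add: u_def)
    qed
  qed
  have "Z.independent (a ` {..n})"
  proof
    assume "Z.dependent (a ` {..n})"
    then obtain u where u: "\<exists>v\<in>a ` {..n}. u v \<noteq> 0" "(\<Sum>v\<in>a ` {..n}. of_int (u v) * v) = 0"
      by (auto simp: Z.dependent_finite)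
    then have "(\<Sum>i\<le>n. of_int (u (a i)) * a i) = 0" by (simp add: sum.reindex[OF inj])
    from zero[of "\<lambda>i. u (a i)", OF this] u(1) show False by auto
  qed
  then obtain k m where km: "\<And>i. i < n \<Longrightarrow> \<bar>of_int k * a i - of_int (m i) - \<beta> $ h i\<bar> < e"
    using Kronecker_thm_2[OF _ inj _ \<open>e > 0\<close>, of "\<lambda>i. \<beta> $ h i"] by (auto simp: a_def)
  show ?thesis
  proof
    fix j :: 'd
    let ?i = "the_inv_into {..<n} h j"
    have "?i < n" "h ?i = j"
      using h the_inv_into_into[of h "{..<n}" j "{..<n}"] by (auto simp: bij_betw_def f_the_inv_into_f)
    then show "\<bar>of_int k * \<alpha> $ j - of_int ((\<chi> j. m (the_inv_into {..<n} h j)) $ j) - \<beta> $ j\<bar> < e"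
      using km[of ?i] by (simp add: a_def)
  qed
qed

text \<open>Dirichlet's theorem on simultaneous approximation: the orbit of \<open>0\<close> returns close to \<open>0\<close>.\<close>

lemma simultaneous_recurrence:
  fixes \<alpha> :: "real^'d"
  assumes "e > 0"
  obtains q :: nat and p :: "int^'d" where "q > 0" "\<And>i. \<bar>real q * \<alpha> $ i - of_int (p $ i)\<bar> < e"
proof -
  define n where "n = CARD('d)"
  obtain h where h: "bij_betw h {..<n} (UNIV :: 'd set)"
    using ex_bij_betw_nat_finite[of "UNIV :: 'd set"] unfolding n_def lessThan_atLeast0 by auto
  obtain N :: nat where N: "1 / e < N" using reals_Archimedean2 by blast
  have "0 < 1 / e" using assms by simp
  with N have N0: "N > 0" by linarith
  have Ne: "1 / real N < e" using N N0 assms by (simp add: field_simps)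
  obtain q p where qp: "0 < q" "\<And>i. i < n \<Longrightarrow> \<bar>of_int q * \<alpha> $ h i - of_int (p i)\<bar> < 1 / N"
    using Dirichlet_approx_simult[OF N0, of n "\<lambda>i. \<alpha> $ h i"] by blast
  show ?thesis
  proof
    show "nat q > 0" using qp by simp
    fix j :: 'd
    let ?i = "the_inv_into {..<n} h j"
    have "?i < n" "h ?i = j"
      using h the_inv_into_into[of h "{..<n}" j "{..<n}"] by (auto simp: bij_betw_def f_the_inv_into_f)
    then show "\<bar>real (nat q) * \<alpha> $ j - of_int ((\<chi> j. p (the_inv_into {..<n} h j)) $ j)\<bar> < e"
      using qp(2)[of ?i] qp(1) Ne by simp
  qed
qed

text \<open>The multiple \<open>k\<close> given by Kronecker's theorem may be negative. Adding to it a large multiple of a return time \<open>q\<close>, for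
  which \<open>q \<alpha>\<close> is very close to the lattice, makes it positive and hardly moves the point.\<close>

lemma forward_orbit_approximates:
  fixes \<alpha> \<beta> :: "real^'d"
  assumes indep: "rationally_independent \<alpha>" and "e > 0"
  obtains k :: nat and p :: "int^'d" where "k > 0" "\<And>i. \<bar>real k * \<alpha> $ i - of_int (p $ i) - \<beta> $ i\<bar> < e"
proof -
  have "e / 2 > 0" using \<open>e > 0\<close> by simp
  obtain k p where k: "\<And>i. \<bar>of_int k * \<alpha> $ i - of_int (p $ i) - \<beta> $ i\<bar> < e / 2"
    using orbit_approximates[OF indep \<open>e / 2 > 0\<close>] by blast
  \<comment> \<open>\<open>r\<close> returns outweigh a negative \<open>k\<close>, and their total error must stay below \<open>e / 2\<close>\<close>
  define r where "r = nat \<bar>k\<bar> + 1"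
  have r_pos: "real r > 0" by (simp add: r_def)
  have "e / (2 * r) > 0" using \<open>e > 0\<close> r_pos by simp
  then obtain q p' where q: "q > 0" "\<And>i. \<bar>real q * \<alpha> $ i - of_int (p' $ i)\<bar> < e / (2 * r)"
    using simultaneous_recurrence by blast
  have pos: "k + int (r * q) > 0"
  proof -
    have "int r * 1 \<le> int r * int q" using q(1) by (intro mult_left_mono) auto
    moreover have "int r > \<bar>k\<bar>" by (simp add: r_def)
    ultimately show ?thesis unfolding of_nat_mult by linarith
  qed
  show ?thesis
  proof
    show "nat (k + int (r * q)) > 0" using pos by simp
    fix i :: 'd
    have "real r * \<bar>real q * \<alpha> $ i - of_int (p' $ i)\<bar> < real r * (e / (2 * r))"
      using q(2)[of i] by (intro mult_strict_left_mono) (auto simp: r_def)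
    also have "\<dots> = e / 2"
      using r_pos by (simp add: field_simps)
    finally have "\<bar>real r * (real q * \<alpha> $ i - of_int (p' $ i))\<bar> < e / 2" by (simp add: abs_mult)
    then have "\<bar>(of_int k * \<alpha> $ i - of_int (p $ i) - \<beta> $ i) + real r * (real q * \<alpha> $ i - of_int (p' $ i))\<bar> < e"
      using k[of i] by linarith
    moreover have "real (nat (k + int (r * q))) = of_int k + real r * real q"
      using pos by simp
    ultimately show "\<bar>real (nat (k + int (r * q))) * \<alpha> $ i - of_int ((p + (\<chi> i. int r * p' $ i)) $ i) - \<beta> $ i\<bar> < e"
      by (simp add: algebra_simps)
  qed
qed

lemma periodic_le_of_orbit:
  fixes \<Phi> :: "real^'d \<Rightarrow> real"
  assumes indep: "rationally_independent \<alpha>" and cont: "continuous_on UNIV \<Phi>"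
    and per: "\<And>x k. \<Phi> (x + lat k) = \<Phi> x"
    and bound: "\<And>k. k > 0 \<Longrightarrow> \<Phi> (\<theta>0 + real k *\<^sub>R \<alpha>) \<le> B"
  shows "\<Phi> \<theta> \<le> B"
proof (rule field_le_epsilon)
  fix e :: real assume "e > 0"
  have "isCont \<Phi> \<theta>" using cont by (simp add: continuous_on_eq_continuous_at)
  then obtain d where d: "d > 0" "\<And>y. dist y \<theta> < d \<Longrightarrow> dist (\<Phi> y) (\<Phi> \<theta>) < e"
    unfolding continuous_at_eps_delta using \<open>e > 0\<close> by blast
  let ?d = "d / CARD('d)"
  have "?d > 0" using d by simp
  then obtain k p where k: "k > 0" "\<And>i. \<bar>real k * \<alpha> $ i - of_int (p $ i) - (\<theta> - \<theta>0) $ i\<bar> < ?d"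
    using forward_orbit_approximates[OF indep] by blast
  define y where "y = \<theta>0 + real k *\<^sub>R \<alpha> + lat (- p)"
  have "dist y \<theta> \<le> (\<Sum>i\<in>UNIV. \<bar>(y - \<theta>) $ i\<bar>)" unfolding dist_norm by (rule norm_le_l1_cart)
  also have "\<dots> < (\<Sum>i\<in>(UNIV::'d set). ?d)"
    using k(2) by (intro sum_strict_mono) (auto simp: y_def lat_def algebra_simps)
  also have "\<dots> = d" by simp
  finally have "\<bar>\<Phi> y - \<Phi> \<theta>\<bar> < e" using d(2) by (simp add: dist_real_def)
  moreover have "\<Phi> y \<le> B" unfolding y_def per by (rule bound[OF k(1)])
  ultimately show "\<Phi> \<theta> \<le> B + e" by linarith
qed

section \<open>Products along the orbit of a zero\<close>

lemma wave_almost_eigen_l2: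
  fixes x :: "real^'d" and \<eta> :: real
  assumes cont: "continuous_on UNIV V" and per: "torus_periodic V" and "\<eta> > 0"
  shows "eventually (\<lambda>e. \<forall>F. folner e F \<longrightarrow>
     l2_bounded (\<lambda>m. (\<Sum>n\<in>F. wave F x n * cnj (fourier_coeff V (n - m))) - cnj (V x) * wave F x m)
       (\<eta> * sqrt (card F))) (at_right 0)"
proof -
  have "\<eta>\<^sup>2 > 0" using \<open>\<eta> > 0\<close> by simp
  from wave_almost_eigen[OF cont per this, of x] obtain e0 where e0: "e0 > 0"
    "\<And>F S. folner e0 F \<Longrightarrow> finite S \<Longrightarrow>
      (\<Sum>m\<in>S. (cmod ((\<Sum>n\<in>F. wave F x n * cnj (fourier_coeff V (n - m))) - cnj (V x) * wave F x m))\<^sup>2) \<le> \<eta>\<^sup>2 * card F"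
    by blast
  have "l2_bounded (\<lambda>m. (\<Sum>n\<in>F. wave F x n * cnj (fourier_coeff V (n - m))) - cnj (V x) * wave F x m)
       (\<eta> * sqrt (card F))" if "folner e F" "e < e0" for e F
    unfolding l2_bounded_def L2_set_def
  proof (intro allI impI)
    fix S :: "(int^'d) set" assume "finite S"
    have "folner e0 F" using that folner_mono by (metis less_imp_le)
    then show "sqrt (\<Sum>m\<in>S. (cmod ((\<Sum>n\<in>F. wave F x n * cnj (fourier_coeff V (n - m))) - cnj (V x) * wave F x m))\<^sup>2)
       \<le> \<eta> * sqrt (card F)"
      using e0(2)[OF _ \<open>finite S\<close>] \<open>\<eta> > 0\<close> by (intro real_le_lsqrt) (auto simp: power_mult_distrib sum_nonneg)
  qed
  then show ?thesis
    using e0(1) unfolding eventually_at_right_field by (intro exI[of _ e0]) auto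
qed

lemma character_mean_small:
  fixes y :: "real^'d" and \<tau> :: real
  assumes "y \<notin> range lat" "\<tau> > 0"
  shows "eventually (\<lambda>e. \<forall>F. folner e F \<longrightarrow> cmod (\<Sum>n\<in>F. character n y) \<le> \<tau> * card F) (at_right 0)"
proof -
  obtain i where "character (axis i 1) y \<noteq> 1"
    using lattice_point_if_characters_eq_1[of y] assms by auto
  then have t: "cmod (character (axis i 1) y - 1) > 0" (is "?t > 0") by simp
  have "cmod (\<Sum>n\<in>F. character n y) \<le> \<tau> * card F" if "folner e F" "e < \<tau> * ?t / 2" for e F
  proof -
    have "cmod (\<Sum>n\<in>F. character n y) * ?t \<le> 2 * e * card F" by (rule folner_character_mean[OF that(1)])
    also have "\<dots> \<le> (\<tau> * ?t) * card F" using that(2) by (intro mult_right_mono) auto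
    finally have "cmod (\<Sum>n\<in>F. character n y) * ?t \<le> (\<tau> * card F) * ?t" by (simp add: mult_ac)
    then show ?thesis using t by (simp only: mult_le_cancel_right_pos)
  qed
  moreover have "\<tau> * ?t / 2 > 0" using t assms by simp
  ultimately show ?thesis
    unfolding eventually_at_right_field by (intro exI[of _ "\<tau> * ?t / 2"]) auto
qed

lemma telescoping_pairs:
  fixes a b :: "nat \<Rightarrow> complex"
  assumes "\<And>j. j < N \<Longrightarrow> b j = - a (Suc j)"
  shows "(\<Sum>j<Suc N. a j + b j) = a 0 + b N"
  using assms by (induction N) auto

lemma wave_l2_bounded: "finite F \<Longrightarrow> l2_bounded (wave F x) (sqrt (card F))"
proof -
  assume F: "finite F"
  have "l2_bounded (wave F x) (L2_set (\<lambda>n. cmod (wave F x n)) F)"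
    by (rule l2_bounded_finite_support[OF F]) (simp add: wave_def)
  moreover have "L2_set (\<lambda>n. cmod (wave F x n)) F = sqrt (card F)"
    by (simp add: L2_set_def wave_def)
  ultimately show ?thesis by simp
qed

lemma wave_inner:
  "(\<Sum>n\<in>F. wave F x n * cnj (wave F y n)) = (\<Sum>n\<in>F. character n (y - x))"
  by (intro sum.cong) (auto simp: wave_def character_diff_right mult.commute)

text \<open>The test vector is the combination of the waves at \<open>x\<^sub>j = \<theta>0 + j \<alpha>\<close> for \<open>j < N\<close> with coefficients
  \<open>c\<^sub>j\<close> such that \<open>c\<^sub>j * cnj l\<close> cancels \<open>c\<^sub>k * cnj (V x\<^sub>k - V \<theta>0)\<close> for \<open>k = j + 1\<close>. The adjoint maps it, up to small errors,
  to \<open>cnj l ^ N\<close> times the wave at \<open>x\<^sub>N\<close>: at the lower end nothing is left since \<open>V x\<^sub>0 - V \<theta>0 = 0\<close>. The left-hand side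
  of the claim is \<open>\<bar>c\<^sub>m\<bar>\<close>, which the inner product with the wave at \<open>x\<^sub>m\<close> extracts.\<close>

lemma orbit_product_bound:
  fixes \<alpha> \<theta>0 :: "real^'d"
  assumes cont: "continuous_on UNIV V" and per: "torus_periodic V"
    and indep: "rationally_independent \<alpha>"
    and low: "dual_lower_bound V \<alpha> l (V \<theta>0) C" and "C \<ge> 0" and "m < N"
  shows "cmod l ^ m * (\<Prod>k=Suc m..<N. cmod (V (\<theta>0 + real k *\<^sub>R \<alpha>) - V \<theta>0)) \<le> C * cmod l ^ N"
proof -
  define x where "x j = \<theta>0 + real j *\<^sub>R \<alpha>" for j
  define g where "g j = V (x j) - V \<theta>0" for j
  \<comment> \<open>the solution of \<open>c j * cnj l + c (Suc j) * cnj (g (Suc j)) = 0\<close> with \<open>c (N - 1) = cnj l ^ (N - 1)\<close>\<close>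
  define c where "c j = cnj l ^ j * (\<Prod>k=Suc j..<N. - cnj (g k))" for j
  define A where "A = (\<Sum>j<N. cmod (c j))"
  have A0: "A \<ge> 0" unfolding A_def by (intro sum_nonneg) simp
  have g0: "g 0 = 0" by (simp add: g_def x_def)
  have c_Suc: "c j * cnj l = - (c (Suc j) * cnj (g (Suc j)))" if "Suc j < N" for j
    using prod.atLeast_Suc_lessThan[OF that, of "\<lambda>k. - cnj (g k)"] by (simp add: c_def)
  obtain N' where N': "N = Suc N'" using \<open>m < N\<close> by (cases N) auto
  have c_last: "c N' * cnj l = cnj l ^ N" by (simp add: c_def N')
  have x_Suc: "x (Suc j) = x j + \<alpha>" for j by (simp add: x_def algebra_simps)
  have key: "cmod (c m) \<le> C * cmod l ^ N + (C * A * \<eta> + A * \<eta>)" if "\<eta> > 0" for \<eta>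
  proof -
    have "eventually (\<lambda>e. \<forall>j\<in>{..<N}. \<forall>F. folner e F \<longrightarrow>
        l2_bounded (\<lambda>m. (\<Sum>n\<in>F. wave F (x j) n * cnj (fourier_coeff V (n - m))) - cnj (V (x j)) * wave F (x j) m)
        (\<eta> * sqrt (card F))) (at_right 0)"
      by (intro eventually_ball_finite ballI wave_almost_eigen_l2[OF cont per that]) simp
    moreover have "eventually (\<lambda>e. \<forall>j\<in>{..<N} - {m}. \<forall>F. folner e F \<longrightarrow>
        cmod (\<Sum>n\<in>F. character n (x m - x j)) \<le> \<eta> * card F) (at_right 0)"
    proof (intro eventually_ball_finite ballI)
      fix j assume "j \<in> {..<N} - {m}"
      then have "of_int (int m - int j) *\<^sub>R \<alpha> \<notin> range lat" by (intro multiple_not_lat[OF indep]) auto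
      then have "x m - x j \<notin> range lat" by (simp add: x_def algebra_simps)
      then show "eventually (\<lambda>e. \<forall>F. folner e F \<longrightarrow> cmod (\<Sum>n\<in>F. character n (x m - x j)) \<le> \<eta> * card F) (at_right 0)"
        by (rule character_mean_small[OF _ that])
    qed simp
    moreover have "eventually (\<lambda>e. e > 0) (at_right (0::real))"
      by (rule eventually_at_right_less)
    ultimately have "eventually (\<lambda>e. (\<forall>j\<in>{..<N}. \<forall>F. folner e F \<longrightarrow>
        l2_bounded (\<lambda>m. (\<Sum>n\<in>F. wave F (x j) n * cnj (fourier_coeff V (n - m))) - cnj (V (x j)) * wave F (x j) m)
        (\<eta> * sqrt (card F))) \<and> (\<forall>j\<in>{..<N} - {m}. \<forall>F. folner e F \<longrightarrow>
        cmod (\<Sum>n\<in>F. character n (x m - x j)) \<le> \<eta> * card F) \<and> e > 0) (at_right 0)"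
      by (intro eventually_conj)
    from eventually_happens'[OF trivial_limit_at_right_real this]
    \<comment> \<open>one \<open>e\<close> for which all \<open>N\<close> waves are almost eigenvectors and almost orthogonal to the wave at \<open>x m\<close>\<close>
    obtain e where e: "e > 0"
      and err: "\<And>j F. j < N \<Longrightarrow> folner e F \<Longrightarrow>
        l2_bounded (\<lambda>m. (\<Sum>n\<in>F. wave F (x j) n * cnj (fourier_coeff V (n - m))) - cnj (V (x j)) * wave F (x j) m)
        (\<eta> * sqrt (card F))"
      and orth: "\<And>j F. j < N \<Longrightarrow> j \<noteq> m \<Longrightarrow> folner e F \<Longrightarrow> cmod (\<Sum>n\<in>F. character n (x m - x j)) \<le> \<eta> * card F"
      by blast
    obtain F :: "(int^'d) set" where F: "folner e F" using folner_exists[OF e] by blast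
    then have fin: "finite F" and ne: "F \<noteq> {}" by (auto simp: folner_def)
    define L where "L = real (card F)"
    have L: "L > 0" using fin ne by (simp add: L_def card_gt_0_iff)
    define E where "E j m = (\<Sum>n\<in>F. wave F (x j) n * cnj (fourier_coeff V (n - m))) - cnj (V (x j)) * wave F (x j) m" for j m
    define f where "f n = (\<Sum>j<N. c j * wave F (x j) n)" for n
    have supp: "f n = 0" if "n \<notin> F" for n using that by (simp add: f_def wave_def)
    have wave_step: "cnj (character n \<alpha>) * wave F (x j) n = wave F (x (Suc j)) n" for n j
      by (simp add: wave_def x_Suc character_add_right mult.commute)
    have dual: "dual_op V \<alpha> l (V \<theta>0) F f n = (\<Sum>j<N. c j * E j n) + cnj l ^ N * wave F (x N) n" for n
    proof -
      have "(\<Sum>p\<in>F. f p * cnj (fourier_coeff V (p - n)))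
          = (\<Sum>j<N. c j * (\<Sum>p\<in>F. wave F (x j) p * cnj (fourier_coeff V (p - n))))"
        unfolding f_def sum_distrib_right sum_distrib_left by (subst sum.swap) (simp add: mult.assoc)
      also have "\<dots> = (\<Sum>j<N. c j * (E j n + cnj (V (x j)) * wave F (x j) n))"
        by (simp add: E_def)
      finally have conv: "(\<Sum>p\<in>F. f p * cnj (fourier_coeff V (p - n)))
          = (\<Sum>j<N. c j * (E j n + cnj (V (x j)) * wave F (x j) n))" .
      have pot: "(cnj l * cnj (character n \<alpha>) - cnj (V \<theta>0)) * f n
          = (\<Sum>j<N. c j * (cnj l * wave F (x (Suc j)) n - cnj (V \<theta>0) * wave F (x j) n))"
        unfolding f_def sum_distrib_left wave_step[symmetric] by (simp add: algebra_simps)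
      have "dual_op V \<alpha> l (V \<theta>0) F f n
         = (\<Sum>j<N. c j * E j n + (c j * cnj (g j) * wave F (x j) n + c j * cnj l * wave F (x (Suc j)) n))"
        unfolding dual_op_def conv pot sum.distrib[symmetric]
        by (intro sum.cong refl) (simp add: g_def algebra_simps)
      also have "\<dots> = (\<Sum>j<N. c j * E j n) + (\<Sum>j<N. c j * cnj (g j) * wave F (x j) n + c j * cnj l * wave F (x (Suc j)) n)"
        by (rule sum.distrib)
      also have "(\<Sum>j<N. c j * cnj (g j) * wave F (x j) n + c j * cnj l * wave F (x (Suc j)) n)
          = c 0 * cnj (g 0) * wave F (x 0) n + c N' * cnj l * wave F (x (Suc N')) n"
        unfolding N' by (rule telescoping_pairs) (simp add: c_Suc N')
      also have "\<dots> = cnj l ^ N * wave F (x N) n"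
        by (simp add: g0 c_last flip: N')
      finally show ?thesis .
    qed
    have "l2_bounded (\<lambda>n. (\<Sum>j<N. c j * E j n) + cnj l ^ N * wave F (x N) n)
        ((\<Sum>j<N. cmod (c j) * (\<eta> * sqrt L)) + cmod (cnj l ^ N) * sqrt L)"
      unfolding L_def E_def
      by (intro l2_bounded_add l2_bounded_sum l2_bounded_scale wave_l2_bounded err F fin) auto
    also have "(\<lambda>n. (\<Sum>j<N. c j * E j n) + cnj l ^ N * wave F (x N) n) = dual_op V \<alpha> l (V \<theta>0) F f"
      by (simp add: fun_eq_iff dual)
    also have "(\<Sum>j<N. cmod (c j) * (\<eta> * sqrt L)) + cmod (cnj l ^ N) * sqrt L = (A * \<eta> + cmod l ^ N) * sqrt L"
      by (simp add: A_def sum_distrib_left sum_distrib_right norm_power algebra_simps)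
    finally have nf: "L2_set (\<lambda>n. cmod (f n)) F \<le> C * ((A * \<eta> + cmod l ^ N) * sqrt L)"
      using low supp fin unfolding dual_lower_bound_def by blast
    have up: "cmod (\<Sum>n\<in>F. f n * cnj (wave F (x m) n)) \<le> C * (A * \<eta> + cmod l ^ N) * L"
    proof -
      have "cmod (\<Sum>n\<in>F. f n * cnj (wave F (x m) n)) \<le> (\<Sum>n\<in>F. \<bar>cmod (f n)\<bar> * \<bar>cmod (wave F (x m) n)\<bar>)"
        by (rule order_trans[OF norm_sum]) (simp add: norm_mult)
      also have "\<dots> \<le> L2_set (\<lambda>n. cmod (f n)) F * L2_set (\<lambda>n. cmod (wave F (x m) n)) F"
        by (rule L2_set_mult_ineq)
      also have "\<dots> \<le> (C * ((A * \<eta> + cmod l ^ N) * sqrt L)) * sqrt L"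
        using wave_l2_bounded[OF fin, of "x m"] fin \<open>C \<ge> 0\<close> A0 that L
        by (intro mult_mono nf) (auto simp: l2_bounded_def L_def)
      also have "\<dots> = C * (A * \<eta> + cmod l ^ N) * L"
        using L by (simp add: mult.assoc)
      finally show ?thesis .
    qed
    have expand: "(\<Sum>n\<in>F. f n * cnj (wave F (x m) n)) = c m * L + (\<Sum>j\<in>{..<N}-{m}. c j * (\<Sum>n\<in>F. character n (x m - x j)))"
    proof -
      have "(\<Sum>n\<in>F. f n * cnj (wave F (x m) n)) = (\<Sum>j<N. c j * (\<Sum>n\<in>F. wave F (x j) n * cnj (wave F (x m) n)))"
        unfolding f_def sum_distrib_right sum_distrib_left by (subst sum.swap) (simp add: mult.assoc)
      also have "\<dots> = (\<Sum>j<N. c j * (\<Sum>n\<in>F. character n (x m - x j)))" by (simp only: wave_inner)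
      also have "\<dots> = c m * (\<Sum>n\<in>F. character n (x m - x m)) + (\<Sum>j\<in>{..<N}-{m}. c j * (\<Sum>n\<in>F. character n (x m - x j)))"
        using \<open>m < N\<close> by (intro sum.remove) auto
      finally show ?thesis by (simp add: L_def)
    qed
    have "cmod (\<Sum>j\<in>{..<N}-{m}. c j * (\<Sum>n\<in>F. character n (x m - x j))) \<le> (\<Sum>j\<in>{..<N}-{m}. cmod (c j) * (\<eta> * L))"
      using orth[OF _ _ F] unfolding L_def
      by (intro order_trans[OF norm_sum] sum_mono) (auto simp: norm_mult intro!: mult_left_mono)
    also have "\<dots> \<le> (\<Sum>j<N. cmod (c j) * (\<eta> * L))"
      using that L by (intro sum_mono2) auto
    also have "\<dots> = A * \<eta> * L" by (simp add: A_def sum_distrib_right mult.assoc)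
    finally have rest: "cmod (\<Sum>j\<in>{..<N}-{m}. c j * (\<Sum>n\<in>F. character n (x m - x j))) \<le> A * \<eta> * L" .
    have "c m * L = (\<Sum>n\<in>F. f n * cnj (wave F (x m) n)) - (\<Sum>j\<in>{..<N}-{m}. c j * (\<Sum>n\<in>F. character n (x m - x j)))"
      using expand by simp
    also have "cmod \<dots> \<le> C * (A * \<eta> + cmod l ^ N) * L + A * \<eta> * L"
      by (rule order_trans[OF norm_triangle_ineq4 add_mono[OF up rest]])
    finally have "cmod (c m * L) \<le> C * (A * \<eta> + cmod l ^ N) * L + A * \<eta> * L" .
    also have "\<dots> = (C * cmod l ^ N + (C * A * \<eta> + A * \<eta>)) * L" by (simp add: algebra_simps)
    finally have "cmod (c m) * L \<le> (C * cmod l ^ N + (C * A * \<eta> + A * \<eta>)) * L"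
      using L by (simp add: norm_mult)
    then show ?thesis using L by (simp only: mult_le_cancel_right_pos)
  qed
  have "cmod (c m) \<le> C * cmod l ^ N"
  proof (rule field_le_epsilon)
    fix e :: real assume "e > 0"
    define \<eta> where "\<eta> = e / (C * A + A + 1)"
    have pos: "C * A + A + 1 > 0" using A0 \<open>C \<ge> 0\<close> by (intro add_nonneg_pos) auto
    have "\<eta> > 0" using pos \<open>e > 0\<close> by (simp add: \<eta>_def)
    have "C * A * \<eta> + A * \<eta> = (C * A + A) * \<eta>" by (simp add: algebra_simps)
    also have "\<dots> \<le> (C * A + A + 1) * \<eta>" using \<open>\<eta> > 0\<close> by (intro mult_right_mono) auto
    also have "\<dots> = e" using pos by (simp add: \<eta>_def)
    finally show "cmod (c m) \<le> C * cmod l ^ N + e" using key[OF \<open>\<eta> > 0\<close>] by linarith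
  qed
  then show ?thesis
    unfolding c_def norm_mult norm_power prod_norm[symmetric] norm_minus_cancel complex_mod_cnj g_def x_def .
qed

section \<open>Logarithmic means\<close>

text \<open>The value at \<open>0\<close> makes a finite integral also say that the argument is nonzero almost everywhere.\<close>

definition abs_log :: "complex \<Rightarrow> ennreal" where
  "abs_log w = (if w = 0 then top else ennreal \<bar>ln (cmod w)\<bar>)"

lemma abs_log_measurable [measurable]: "abs_log \<in> borel_measurable borel"
  unfolding abs_log_def[abs_def] by measurable

definition inv_sqrt :: "real \<Rightarrow> real \<Rightarrow> ennreal" where
  "inv_sqrt c s = ennreal (s powr (-1/2)) * indicator {0..c} s"

lemma inv_sqrt_measurable [measurable]: "inv_sqrt c \<in> borel_measurable borel"
  unfolding inv_sqrt_def[abs_def] by measurable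

lemma inv_sqrt_integral: "c \<ge> 0 \<Longrightarrow> (\<integral>\<^sup>+s. inv_sqrt c s \<partial>lborel) < top"
proof -
  assume "c \<ge> 0"
  obtain I where I: "((\<lambda>s::real. s powr (-1/2)) has_integral I) {0..c}"
    using integrable_on_powr_from_0[of "-1/2" c] \<open>c \<ge> 0\<close> by auto
  have "(\<integral>\<^sup>+s. inv_sqrt c s \<partial>lborel) = (\<integral>\<^sup>+s. ennreal (indicator {0..c} s * s powr (-1/2)) \<partial>lborel)"
    by (intro nn_integral_cong) (auto simp: inv_sqrt_def indicator_def)
  also have "\<dots> = ennreal I"
    using nn_integral_has_integral_lebesgue[OF _ I] by (simp add: mult.commute nn_integral_completion)
  finally show ?thesis by simp
qed

lemma abs_ln_le: "x > 0 \<Longrightarrow> \<bar>ln x\<bar> \<le> x + 2 * x powr (-1/2)"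
  for x :: real
proof -
  assume x: "x > 0"
  have "ln x \<le> x" using ln_le_minus_one[OF x] by simp
  moreover have "- ln x \<le> 2 * x powr (-1/2)"
  proof -
    \<comment> \<open>\<open>- ln x\<close> is twice the logarithm of \<open>x powr (-1/2)\<close>\<close>
    have "ln (x powr (-1/2)) \<le> x powr (-1/2) - 1" using x by (intro ln_le_minus_one) simp
    then show ?thesis using x by (simp add: ln_powr)
  qed
  moreover have "x powr (-1/2) \<ge> 0" by simp
  ultimately show ?thesis using x unfolding abs_le_iff by linarith
qed

text \<open>The modulus is at least \<open>\<bar>Re w\<bar>\<close>, so the singularity is no worse than \<open>\<bar>Re w\<bar> powr (-1/2)\<close>, which is integrable
  along horizontal lines. Of the two functions on the right, one takes care of each sign of \<open>Re w\<close>.\<close>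

lemma abs_log_le:
  assumes "Re w \<noteq> 0" "cmod w \<le> c"
  shows "abs_log w \<le> ennreal c + 2 * (inv_sqrt c (Re w) + inv_sqrt c (- Re w))"
proof -
  let ?r = "\<bar>Re w\<bar>"
  have r: "?r > 0" "?r \<le> cmod w" using assms abs_Re_le_cmod by auto
  have "\<bar>ln (cmod w)\<bar> \<le> cmod w + 2 * cmod w powr (-1/2)"
    using r by (intro abs_ln_le) linarith
  also have "\<dots> \<le> c + 2 * ?r powr (-1/2)"
    using r assms by (intro add_mono mult_left_mono powr_mono2') auto
  finally have "abs_log w \<le> ennreal (c + 2 * ?r powr (-1/2))"
    using assms unfolding abs_log_def by (auto intro: ennreal_leI)
  also have "\<dots> = ennreal c + 2 * ennreal (?r powr (-1/2))"
    using r assms by (subst ennreal_plus) (auto simp: ennreal_mult)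
  also have "ennreal (?r powr (-1/2)) \<le> inv_sqrt c (Re w) + inv_sqrt c (- Re w)"
    using r assms by (cases "Re w > 0") (auto simp: inv_sqrt_def)
  finally show ?thesis by (simp add: add_left_mono mult_left_mono)
qed

text \<open>The bound is uniform in \<open>w\<close>: a change of \<open>w\<close> translates the two functions \<open>inv_sqrt\<close> along the line, and their integrals
  over the whole line stay the same.\<close>

lemma abs_log_line_integral:
  assumes "c \<ge> 0"
  shows "\<exists>M<top. \<forall>w. cmod w + d \<le> c \<longrightarrow> (\<integral>\<^sup>+t. abs_log (w - of_real t) * indicator {-d..d} t \<partial>lborel) \<le> M"
proof -
  let ?J = "\<integral>\<^sup>+s. inv_sqrt c s \<partial>lborel"
  let ?M = "ennreal c * emeasure lborel {-d..d} + 2 * (?J + ?J)"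
  have "(\<integral>\<^sup>+t. abs_log (w - of_real t) * indicator {-d..d} t \<partial>lborel) \<le> ?M" if w: "cmod w + d \<le> c" for w
  proof -
    let ?b = "\<lambda>t. ennreal c * indicator {-d..d} t + 2 * (inv_sqrt c (Re w - t) + inv_sqrt c (- Re w + t))"
    have "AE t in lborel. t \<noteq> Re w" by (rule AE_lborel_singleton)
    then have "AE t in lborel. abs_log (w - of_real t) * indicator {-d..d} t \<le> ?b t"
    proof eventually_elim
      case (elim t)
      show ?case
      proof (cases "t \<in> {-d..d}")
        case True
        have "cmod (w - of_real t) \<le> cmod w + \<bar>t\<bar>"
          using norm_triangle_ineq4[of w "of_real t"] by simp
        also have "\<dots> \<le> c" using True w by auto
        finally have "abs_log (w - of_real t) \<le> ennreal c + 2 * (inv_sqrt c (Re (w - of_real t)) + inv_sqrt c (- Re (w - of_real t)))"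
          using elim by (intro abs_log_le) auto
        then show ?thesis using True by simp
      qed simp
    qed
    then have "(\<integral>\<^sup>+t. abs_log (w - of_real t) * indicator {-d..d} t \<partial>lborel) \<le> (\<integral>\<^sup>+t. ?b t \<partial>lborel)"
      by (rule nn_integral_mono_AE)
    also have "\<dots> = ennreal c * emeasure lborel {-d..d}
        + 2 * ((\<integral>\<^sup>+t. inv_sqrt c (Re w - t) \<partial>lborel) + (\<integral>\<^sup>+t. inv_sqrt c (- Re w + t) \<partial>lborel))"
      by (simp add: nn_integral_add nn_integral_cmult)
    also have "(\<integral>\<^sup>+t. inv_sqrt c (- Re w + t) \<partial>lborel) = ?J"
      by (rule nn_integral_lborel_shift) measurable
    also have "(\<integral>\<^sup>+t. inv_sqrt c (Re w - t) \<partial>lborel) = (\<integral>\<^sup>+t. inv_sqrt c (Re w - t) \<partial>distr lborel borel uminus)"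
      by (simp add: lborel_distr_uminus)
    also have "\<dots> = (\<integral>\<^sup>+t. inv_sqrt c (Re w + t) \<partial>lborel)"
      by (subst nn_integral_distr) auto
    also have "\<dots> = ?J"
      by (rule nn_integral_lborel_shift) measurable
    finally show ?thesis .
  qed
  moreover have "?M < top"
    using inv_sqrt_integral[OF assms] by (auto simp: ennreal_mult_less_top emeasure_lborel_Icc_eq)
  ultimately show ?thesis by blast
qed

text \<open>By Fubini's theorem and the bound along horizontal lines, the integral over \<open>\<theta>\<close> is a function of \<open>t\<close> with finite
  integral over \<open>{-d..d}\<close>; so it is finite for some \<open>t\<close>.\<close>

lemma generic_log_integrable:
  fixes V :: "real^'d \<Rightarrow> complex"
  assumes cont: "continuous_on UNIV V" and per: "torus_periodic V" and "d > 0"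
  obtains t :: real where "\<bar>t\<bar> < d" "integrable torus (\<lambda>\<theta>. ln (cmod (V \<theta> - (z0 + of_real t))))"
    "AE \<theta> in torus. V \<theta> \<noteq> z0 + of_real t"
proof -
  have [measurable]: "V \<in> borel_measurable borel" using cont by (rule borel_measurable_continuous_onI)
  obtain B where B: "B \<ge> 0" "\<And>x. cmod (V x) \<le> B" using periodic_bounded[OF cont per] by blast
  define c where "c = B + cmod z0 + d"
  have "c \<ge> 0" using B \<open>d > 0\<close> by (simp add: c_def)
  from abs_log_line_integral[OF this, of d] obtain M where M: "M < top"
    "\<And>w. cmod w + d \<le> c \<Longrightarrow> (\<integral>\<^sup>+t. abs_log (w - of_real t) * indicator {-d..d} t \<partial>lborel) \<le> M" by blast
  interpret torus: finite_measure "torus :: (real^'d) measure" by (rule finite_measure_torus)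
  interpret P: pair_sigma_finite "torus :: (real^'d) measure" "lborel :: real measure" ..
  let ?q = "\<lambda>\<theta> t. abs_log ((V \<theta> - z0) - of_real t) * indicator {-d..d} t"
  have "(\<integral>\<^sup>+t. (\<integral>\<^sup>+\<theta>. ?q \<theta> t \<partial>torus) \<partial>lborel) = (\<integral>\<^sup>+\<theta>. (\<integral>\<^sup>+t. ?q \<theta> t \<partial>lborel) \<partial>torus)"
    by (rule P.Fubini') measurable
  also have "\<dots> \<le> (\<integral>\<^sup>+\<theta>. M \<partial>(torus :: (real^'d) measure))"
  proof (rule nn_integral_mono)
    fix \<theta>
    have "cmod (V \<theta> - z0) + d \<le> c"
      using norm_triangle_ineq4[of "V \<theta>" z0] B(2)[of \<theta>] by (simp add: c_def)
    then show "(\<integral>\<^sup>+t. ?q \<theta> t \<partial>lborel) \<le> M" by (rule M(2))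
  qed
  also have "\<dots> = M" by simp
  finally have fin: "(\<integral>\<^sup>+t. (\<integral>\<^sup>+\<theta>. ?q \<theta> t \<partial>torus) \<partial>lborel) < top" using M(1) by (rule le_less_trans)
  have "\<exists>t. \<bar>t\<bar> < d \<and> (\<integral>\<^sup>+\<theta>. abs_log ((V \<theta> - z0) - of_real t) \<partial>torus) \<noteq> top"
  proof (rule ccontr)
    assume "\<not> ?thesis"
    then have inf: "\<And>t. \<bar>t\<bar> < d \<Longrightarrow> (\<integral>\<^sup>+\<theta>. abs_log ((V \<theta> - z0) - of_real t) \<partial>torus) = top" by blast
    have "top = (\<integral>\<^sup>+t. top * indicator {-d<..<d} t \<partial>lborel)"
      using \<open>d > 0\<close> by (subst nn_integral_cmult_indicator) (auto simp: ennreal_top_mult)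
    also have "\<dots> \<le> (\<integral>\<^sup>+t. (\<integral>\<^sup>+\<theta>. ?q \<theta> t \<partial>torus) \<partial>lborel)"
    proof (rule nn_integral_mono)
      fix t :: real
      show "top * indicator {-d<..<d} t \<le> (\<integral>\<^sup>+\<theta>. ?q \<theta> t \<partial>torus)"
      proof (cases "\<bar>t\<bar> < d")
        case True
        then have "(\<integral>\<^sup>+\<theta>. ?q \<theta> t \<partial>torus) = top" using inf[OF True] by (auto simp: indicator_def)
        then show ?thesis by simp
      qed (auto simp: indicator_def)
    qed
    finally show False using fin by (simp add: top_unique)
  qed
  then obtain t where t: "\<bar>t\<bar> < d" "(\<integral>\<^sup>+\<theta>. abs_log ((V \<theta> - z0) - of_real t) \<partial>torus) \<noteq> top" by blast
  have "AE \<theta> in torus. abs_log ((V \<theta> - z0) - of_real t) \<noteq> top"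
    by (rule nn_integral_PInf_AE[OF _ t(2)[unfolded infinity_ennreal_def[symmetric]], unfolded infinity_ennreal_def]) measurable
  then have ne: "AE \<theta> in torus. V \<theta> \<noteq> z0 + of_real t"
    by eventually_elim (auto simp: abs_log_def)
  have "(\<integral>\<^sup>+\<theta>. ennreal (norm (ln (cmod (V \<theta> - (z0 + of_real t))))) \<partial>torus) \<le> (\<integral>\<^sup>+\<theta>. abs_log ((V \<theta> - z0) - of_real t) \<partial>torus)"
    by (intro nn_integral_mono) (auto simp: abs_log_def diff_diff_eq)
  also have "\<dots> < top" using t(2) by (simp add: less_top)
  finally have "integrable torus (\<lambda>\<theta>. ln (cmod (V \<theta> - (z0 + of_real t))))"
    by (intro integrableI_bounded) measurable
  then show ?thesis using that t(1) ne by blast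
qed

lemma AE_torus_shift:
  assumes [measurable]: "Measurable.pred borel P" and per: "\<And>x k. P (x + lat k) = P x"
    and AE: "AE x in torus. P x"
  shows "AE x in torus. P (x + a)"
proof -
  let ?N = "\<lambda>x. if P x then 0 else (1::ennreal)"
  have "(\<integral>\<^sup>+x. ?N x \<partial>torus) = 0"
    using AE by (subst nn_integral_0_iff_AE) auto
  then have "(\<integral>\<^sup>+x. ?N (x + a) \<partial>torus) = 0"
    by (subst nn_integral_torus_shift[where f="?N"]) (auto simp: per)
  then have "AE x in torus. ?N (x + a) = 0"
    by (subst (asm) nn_integral_0_iff_AE) auto
  then show ?thesis by eventually_elim (auto split: if_splits)
qed

text \<open>Integrate the logarithm of the bound: by translation invariance each of the \<open>n\<close> factors contributes the same integral. The
  constant \<open>C\<close> and the additional factor \<open>r\<close> disappear after division by \<open>n\<close>.\<close>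

lemma log_mean_le_of_product_bound:
  fixes g :: "real^'d \<Rightarrow> complex"
  assumes [measurable]: "g \<in> borel_measurable borel" and per: "\<And>x k. g (x + lat k) = g x"
    and int: "integrable torus (\<lambda>\<theta>. ln (cmod (g \<theta>)))" and ne: "AE \<theta> in torus. g \<theta> \<noteq> 0"
    and bound: "\<And>n \<theta>. (\<Prod>k<n. cmod (g (\<theta> + real k *\<^sub>R \<alpha>))) \<le> C * r ^ Suc n"
    and "r > 0"
  shows "(\<integral>\<theta>. ln (cmod (g \<theta>)) \<partial>torus) \<le> ln r"
proof -
  let ?I = "\<integral>\<theta>. ln (cmod (g \<theta>)) \<partial>torus"
  have "1 \<le> C * r" using bound[where n=0] by simp
  then have "0 < C * r" by linarith
  then have "C > 0" using \<open>r > 0\<close> by (simp add: zero_less_mult_iff)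
  have ints: "integrable torus (\<lambda>\<theta>. ln (cmod (g (\<theta> + a))))"
    and eqs: "(\<integral>\<theta>. ln (cmod (g (\<theta> + a))) \<partial>torus) = ?I" for a
    using integral_torus_shift_real[OF int, of a] by (simp_all add: per)
  interpret torus: finite_measure "torus :: (real^'d) measure" by (rule finite_measure_torus)
  have main: "real n * ?I \<le> ln C + real (Suc n) * ln r" for n
  proof -
    have "AE \<theta> in torus. \<forall>k<n. g (\<theta> + real k *\<^sub>R \<alpha>) \<noteq> 0"
      unfolding AE_all_countable
      by (intro allI AE_impI AE_torus_shift[where P="\<lambda>x. g x \<noteq> 0"] ne) (auto simp: per)
    then have ae: "AE \<theta> in torus. (\<Sum>k<n. ln (cmod (g (\<theta> + real k *\<^sub>R \<alpha>)))) \<le> ln C + real (Suc n) * ln r"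
    proof eventually_elim
      case (elim \<theta>)
      have "(\<Sum>k<n. ln (cmod (g (\<theta> + real k *\<^sub>R \<alpha>)))) = ln (\<Prod>k<n. cmod (g (\<theta> + real k *\<^sub>R \<alpha>)))"
        using elim by (subst ln_prod) auto
      also have "\<dots> \<le> ln (C * r ^ Suc n)"
        using elim bound[where n=n and \<theta>=\<theta>] by (subst ln_le_cancel_iff) (auto intro!: prod_pos mult_pos_pos zero_less_power \<open>C > 0\<close> \<open>r > 0\<close>)
      also have "\<dots> = ln C + real (Suc n) * ln r"
        using \<open>C > 0\<close> \<open>r > 0\<close> by (subst ln_mult_pos) (auto simp: ln_realpow simp del: power_Suc)
      finally show ?case .
    qed
    have "real n * ?I = (\<integral>\<theta>. (\<Sum>k<n. ln (cmod (g (\<theta> + real k *\<^sub>R \<alpha>)))) \<partial>torus)"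
      by (simp add: Bochner_Integration.integral_sum ints eqs)
    also have "\<dots> \<le> (\<integral>\<theta>. ln C + real (Suc n) * ln r \<partial>(torus :: (real^'d) measure))"
      by (intro integral_mono_AE Bochner_Integration.integrable_sum ints ae) simp
    also have "\<dots> = ln C + real (Suc n) * ln r" by (simp add: measure_def)
    finally show ?thesis .
  qed
  show ?thesis
  proof (rule ccontr)
    assume "\<not> ?I \<le> ln r"
    then have pos: "?I - ln r > 0" by simp
    obtain n :: nat where "(ln C + ln r) / (?I - ln r) < n" using reals_Archimedean2 by blast
    then have "ln C + ln r < n * (?I - ln r)" using pos by (simp add: field_simps)
    with main[of n] show False by (simp add: algebra_simps)
  qed
qed

section \<open>Real analytic maps of full rank\<close>

lemma norm_prod_power_le:
  fixes h :: "real^'d"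
  assumes "norm h \<le> s" "s > 0" "sum m UNIV \<ge> 2"
  shows "\<bar>\<Prod>i\<in>UNIV. h $ i ^ m i\<bar> \<le> s ^ sum m UNIV * (norm h / s)\<^sup>2"
proof -
  have "\<bar>\<Prod>i\<in>UNIV. h $ i ^ m i\<bar> = (\<Prod>i\<in>UNIV. \<bar>h $ i\<bar> ^ m i)"
    by (simp add: abs_prod power_abs)
  also have "\<dots> \<le> (\<Prod>i\<in>UNIV. norm h ^ m i)"
    by (intro prod_mono conjI power_mono component_le_norm_cart) auto
  also have "\<dots> = norm h ^ sum m UNIV" by (simp add: power_sum)
  also have "\<dots> = s ^ sum m UNIV * (norm h / s) ^ sum m UNIV"
    using assms by (simp add: power_divide)
  also have "\<dots> \<le> s ^ sum m UNIV * (norm h / s)\<^sup>2"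
    using assms by (intro mult_left_mono power_decreasing) auto
  finally show ?thesis .
qed

text \<open>The terms of degree at least two add up to at most \<open>(norm h / s)\<^sup>2\<close> times the sum of the moduli of the terms of the
  series at the point displaced by \<open>s\<close> in each coordinate, and this sum is finite.\<close>

lemma power_series_linear_approx:
  fixes f :: "real^'d \<Rightarrow> complex"
  assumes r: "r > 0" and ser: "\<And>y. dist x y < r \<Longrightarrow>
     ((\<lambda>m. a m * complex_of_real (\<Prod>i\<in>UNIV. (y $ i - x $ i) ^ m i)) has_sum f y) UNIV"
  shows "\<exists>K s. s > 0 \<and> (\<forall>h. norm h \<le> s \<longrightarrow>
     cmod (f (x + h) - a (\<lambda>_. 0) - (\<Sum>i\<in>UNIV. a (\<lambda>j. if j = i then 1 else 0) * complex_of_real (h $ i))) \<le> K * (norm h)\<^sup>2)"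
proof -
  \<comment> \<open>small enough for the point with all coordinates displaced by \<open>s\<close> to lie in the domain of convergence\<close>
  define s where "s = r / (2 * CARD('d))"
  have s: "s > 0" using r by (simp add: s_def)
  have sr: "s < r"
  proof -
    have "s \<le> r / 2" unfolding s_def using r by (intro divide_left_mono) auto
    then show ?thesis using r by simp
  qed
  define T where "T = insert (\<lambda>_. 0) (range (\<lambda>i j. if j = i then 1 else 0 :: nat) :: ('d \<Rightarrow> nat) set)"
  let ?e = "\<lambda>i j. if j = i then 1 else 0 :: nat"
  have finT: "finite T" by (simp add: T_def)
  have inj: "inj (?e :: 'd \<Rightarrow> 'd \<Rightarrow> nat)"
    by (rule injI) (metis one_neq_zero)
  have notin: "(\<lambda>_. 0) \<notin> range (?e :: 'd \<Rightarrow> 'd \<Rightarrow> nat)"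
  proof
    assume "(\<lambda>_. 0) \<in> range (?e :: 'd \<Rightarrow> 'd \<Rightarrow> nat)"
    then obtain i :: 'd where "(\<lambda>_. 0) = ?e i" by blast
    from fun_cong[OF this, of i] show False by simp
  qed
  have outside: "sum m UNIV \<ge> 2" if "m \<notin> T" for m :: "'d \<Rightarrow> nat"
  proof (rule ccontr)
    assume "\<not> 2 \<le> sum m UNIV"
    then consider "sum m UNIV = 0" | "sum m UNIV = 1" by linarith
    then show False
    proof cases
      case 1
      then have "m = (\<lambda>_. 0)" by (auto simp: fun_eq_iff)
      then show ?thesis using that by (simp add: T_def)
    next
      case 2
      then obtain i where i: "m i = 1" "\<And>j. j \<noteq> i \<Longrightarrow> m j = 0"
        using sum_eq_1_iff[of UNIV m] by auto
      then have "m = ?e i" by (auto simp: fun_eq_iff)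
      then show ?thesis using that by (auto simp: T_def)
    qed
  qed
  have "dist x (\<chi> i. x $ i + s) < r"
  proof -
    have "dist x (\<chi> i. x $ i + s) \<le> (\<Sum>i\<in>UNIV. \<bar>(x - (\<chi> i. x $ i + s)) $ i\<bar>)"
      unfolding dist_norm by (rule norm_le_l1_cart)
    also have "\<dots> = r / 2" using r by (simp add: s_def)
    finally show ?thesis using r by simp
  qed
  from ser[OF this] have "(\<lambda>m. a m * complex_of_real (s ^ sum m UNIV)) summable_on UNIV"
    by (auto simp: summable_on_def power_sum)
  then have "(\<lambda>m. cmod (a m) * s ^ sum m UNIV) summable_on UNIV"
    using s by (simp add: summable_on_iff_abs_summable_on_complex norm_mult norm_power)
  then have "(\<lambda>m. cmod (a m) * s ^ sum m UNIV) summable_on (UNIV - T)"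
    by (rule summable_on_subset_banach) simp
  then obtain M where M: "((\<lambda>m. cmod (a m) * s ^ sum m UNIV) has_sum M) (UNIV - T)"
    unfolding summable_on_def by blast
  have "cmod (f (x + h) - a (\<lambda>_. 0) - (\<Sum>i\<in>UNIV. a (?e i) * complex_of_real (h $ i))) \<le> (M / s\<^sup>2) * (norm h)\<^sup>2"
    if h: "norm h \<le> s" for h
  proof -
    let ?t = "\<lambda>m. a m * complex_of_real (\<Prod>i\<in>UNIV. h $ i ^ m i)"
    have "dist x (x + h) < r" using h sr by (simp add: dist_norm)
    from ser[OF this] have "(?t has_sum f (x + h)) UNIV" by simp
    then have "(?t has_sum (f (x + h) - sum ?t T)) (UNIV - T)"
      by (rule has_sum_Diff[OF _ has_sum_finite[OF finT]]) simp
    moreover have "sum ?t T = a (\<lambda>_. 0) + (\<Sum>i\<in>UNIV. a (?e i) * complex_of_real (h $ i))"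
    proof -
      have "sum ?t T = ?t (\<lambda>_. 0) + sum ?t (range ?e)"
        unfolding T_def using notin by (subst sum.insert) auto
      also have "sum ?t (range ?e) = (\<Sum>i\<in>UNIV. ?t (?e i))"
        by (subst sum.reindex[OF inj]) simp
      also have "\<dots> = (\<Sum>i\<in>UNIV. a (?e i) * complex_of_real (h $ i))"
      proof (intro sum.cong refl)
        fix i
        have "(\<Prod>j\<in>UNIV. h $ j ^ ?e i j) = (\<Prod>j\<in>UNIV. if j = i then h $ j else 1)"
          by (intro prod.cong) auto
        then show "?t (?e i) = a (?e i) * complex_of_real (h $ i)" by simp
      qed
      finally show ?thesis by simp
    qed
    ultimately have *: "(?t has_sum (f (x + h) - (a (\<lambda>_. 0) + (\<Sum>i\<in>UNIV. a (?e i) * complex_of_real (h $ i))))) (UNIV - T)"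
      by simp
    have "cmod (f (x + h) - (a (\<lambda>_. 0) + (\<Sum>i\<in>UNIV. a (?e i) * complex_of_real (h $ i)))) \<le> M * (norm h / s)\<^sup>2"
    proof (rule norm_infsum_le[OF * has_sum_cmult_left[OF M]])
      fix m assume "m \<in> UNIV - T"
      then have "cmod (?t m) \<le> cmod (a m) * (s ^ sum m UNIV * (norm h / s)\<^sup>2)"
        unfolding norm_mult norm_of_real
        by (intro mult_left_mono norm_prod_power_le h s outside) auto
      then show "cmod (?t m) \<le> cmod (a m) * s ^ sum m UNIV * (norm h / s)\<^sup>2" by (simp add: mult.assoc)
    qed
    then show ?thesis by (simp add: power_divide diff_diff_eq)
  qed
  with s show ?thesis by blast
qed

lemma real_analytic_has_derivative:
  assumes "real_analytic f"
  shows "\<exists>f'. (f has_derivative f') (at x)"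
proof -
  obtain r a where r: "r > 0" "\<And>y. dist x y < r \<Longrightarrow>
     ((\<lambda>m. a m * complex_of_real (\<Prod>i\<in>UNIV. (y $ i - x $ i) ^ m i)) has_sum f y) UNIV"
    using assms unfolding real_analytic_def by blast
  define D where "D h = (\<Sum>i\<in>UNIV. a (\<lambda>j. if j = i then 1 else 0) * complex_of_real (h $ i))" for h :: "real^'a"
  from power_series_linear_approx[OF r] obtain K s where s: "s > 0"
    and K: "\<And>h. norm h \<le> s \<Longrightarrow> cmod (f (x + h) - a (\<lambda>_. 0) - D h) \<le> K * (norm h)\<^sup>2"
    unfolding D_def by blast
  have a0: "f x = a (\<lambda>_. 0)"
    using K[of 0] s by (simp add: D_def)
  have "bounded_linear D"
    unfolding D_def
    by (intro bounded_linear_sum bounded_linear_const_mult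
        bounded_linear_compose[OF bounded_linear_of_real] bounded_linear_vec_nth)
  moreover have "((\<lambda>h. norm (f (x + h) - f x - D h) / norm h) \<longlongrightarrow> 0) (at 0)"
  proof (rule Lim_null_comparison)
    show "((\<lambda>h::real^'a. \<bar>K\<bar> * norm h) \<longlongrightarrow> 0) (at 0)"
      by (auto intro!: tendsto_eq_intros)
    have "eventually (\<lambda>h. h \<in> ball 0 s - {0}) (at (0::real^'a))"
      unfolding eventually_at using s by (auto simp: dist_norm)
    then show "eventually (\<lambda>h. norm (norm (f (x + h) - f x - D h) / norm h) \<le> \<bar>K\<bar> * norm h) (at 0)"
    proof eventually_elim
      case (elim h)
      then have h: "norm h \<le> s" "norm h > 0" by auto
      have "norm (f (x + h) - f x - D h) \<le> K * (norm h)\<^sup>2" using K[OF h(1)] by (simp add: a0)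
      also have "\<dots> \<le> \<bar>K\<bar> * (norm h)\<^sup>2" by (intro mult_right_mono) auto
      finally show ?case using h by (simp add: field_simps power2_eq_square)
    qed
  qed
  ultimately show ?thesis unfolding has_derivative_at by blast
qed

lemma real_analytic_continuous: "real_analytic f \<Longrightarrow> continuous_on UNIV f"
  using real_analytic_has_derivative has_derivative_continuous
  by (metis continuous_at_imp_continuous_on)

lemma partial_deriv_Re_Im:
  assumes "(V has_derivative V') (at \<theta>)"
  shows "partial_deriv i (\<lambda>x. Re (V x)) \<theta> = Re (V' (axis i 1))"
    "partial_deriv i (\<lambda>x. Im (V x)) \<theta> = Im (V' (axis i 1))"
proof -
  have line: "((\<lambda>t. \<theta> + t *\<^sub>R axis i 1) has_derivative (\<lambda>t. t *\<^sub>R axis i 1)) (at 0)"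
    by (auto intro!: derivative_eq_intros)
  have "(V has_derivative V') (at (\<theta> + 0 *\<^sub>R axis i 1))" using assms by simp
  from has_derivative_compose[OF line this]
  have comp: "((\<lambda>t. V (\<theta> + t *\<^sub>R axis i 1)) has_derivative (\<lambda>t. V' (t *\<^sub>R axis i 1))) (at 0)" .
  have lin: "V' (t *\<^sub>R axis i 1) = t *\<^sub>R V' (axis i 1)" for t
    using has_derivative_linear[OF assms] by (simp add: linear_scale)
  have "((\<lambda>t. Re (V (\<theta> + t *\<^sub>R axis i 1))) has_derivative (\<lambda>t. t *\<^sub>R Re (V' (axis i 1)))) (at 0)"
    using has_derivative_Re[OF comp] by (simp add: lin)
  then show "partial_deriv i (\<lambda>x. Re (V x)) \<theta> = Re (V' (axis i 1))"
    unfolding partial_deriv_def by (intro DERIV_imp_deriv) (simp add: has_field_derivative_def mult_commute_abs)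
  have "((\<lambda>t. Im (V (\<theta> + t *\<^sub>R axis i 1))) has_derivative (\<lambda>t. t *\<^sub>R Im (V' (axis i 1)))) (at 0)"
    using has_derivative_Im[OF comp] by (simp add: lin)
  then show "partial_deriv i (\<lambda>x. Im (V x)) \<theta> = Im (V' (axis i 1))"
    unfolding partial_deriv_def by (intro DERIV_imp_deriv) (simp add: has_field_derivative_def mult_commute_abs)
qed

text \<open>The transposed Jacobian matrix represents the derivative in the coordinates \<open>(Re, Im)\<close> of \<open>\<complex>\<close>.\<close>

lemma full_rank_surj_derivative:
  fixes V' :: "real^'d \<Rightarrow> complex"
  assumes der: "(V has_derivative V') (at \<theta>)" and rank: "rank (ReIm_jacobian V \<theta>) = 2"
  shows "surj V'"
proof -
  let ?A = "transpose (ReIm_jacobian V \<theta>)"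
  have lin: "linear V'" using has_derivative_linear[OF der] .
  have "rank ?A = CARD(2)" using rank by (simp add: rank_transpose)
  then have surj: "surj ((*v) ?A)" unfolding full_rank_surjective .
  have V': "V' h = Complex ((?A *v h) $ 1) ((?A *v h) $ 2)" for h
  proof -
    have "V' h = V' (\<Sum>i\<in>UNIV. h $ i *\<^sub>R axis i 1)"
      using basis_expansion[of h] by (simp add: scalar_mult_eq_scaleR)
    also have "\<dots> = (\<Sum>i\<in>UNIV. h $ i *\<^sub>R V' (axis i 1))"
      using lin by (simp add: linear_sum linear_scale)
    finally show ?thesis
      by (simp add: complex_eq_iff matrix_vector_mult_def transpose_def ReIm_jacobian_def
          partial_deriv_Re_Im[OF der] mult.commute)
  qed
  show ?thesis
  proof (rule surjI)
    fix w
    let ?v = "vector [Re w, Im w] :: real^2"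
    have "?A *v (inv ((*v) ?A) ?v) = ?v" by (rule surj_f_inv_f[OF surj])
    then show "V' (inv ((*v) ?A) ?v) = w" by (simp add: V' complex_eq_iff)
  qed
qed

text \<open>Sussmann's open mapping theorem: a continuous map that is differentiable at a point, with surjective derivative there, maps
  neighbourhoods of that point to neighbourhoods of its value.\<close>

lemma value_interior_of_range:
  assumes an: "real_analytic V" and rank: "rank (ReIm_jacobian V \<theta>) = 2"
  shows "V \<theta> \<in> interior (range V)"
proof -
  obtain V' where V': "(V has_derivative V') (at \<theta>)"
    using real_analytic_has_derivative[OF an] by blast
  have lin: "linear V'" using has_derivative_linear[OF V'] .
  obtain g where g: "linear g" "V' \<circ> g = id"
    using linear_surjective_right_inverse[OF lin full_rank_surj_derivative[OF V' rank]] by blast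
  show ?thesis
    by (rule sussmann_open_mapping[OF open_UNIV real_analytic_continuous[OF an] UNIV_I V' _ g(2)])
      (use g(1) in \<open>auto simp: linear_conv_bounded_linear\<close>)
qed

section \<open>Two-dimensional spectrum\<close>

text \<open>A bounded inverse of \<open>H - z0\<close> gives the dual lower bound at \<open>z0\<close> and at all nearby points. The argument is carried out at
  a nearby \<open>z\<close> for which \<open>G V z\<close> is a convergent integral; since \<open>z0\<close> is an interior point of the range, \<open>V - z\<close> still has a zero,
  at which the orbit starts.\<close>

lemma interior_range_subset_spectrum:
  fixes V :: "real^'d \<Rightarrow> complex"
  assumes cont: "continuous_on UNIV V" and per: "torus_periodic V"
    and indep: "rationally_independent \<alpha>" and small: "cmod lam < exp_min_G V"
  shows "interior (range V) \<subseteq> ell2_spectrum (H V \<alpha> lam \<omega>)"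
proof (rule subsetI, rule ccontr)
  fix z0 assume z0: "z0 \<in> interior (range V)" "z0 \<notin> ell2_spectrum (H V \<alpha> lam \<omega>)"
  define l where "l = lam * cis (2 * pi * \<omega>)"
  have norm_l: "cmod l = cmod lam" by (simp add: l_def norm_mult)
  obtain C where C: "C \<ge> 0" "dual_lower_bound V \<alpha> l z0 C"
    using resolvent_dual_lower_bound[OF cont per z0(2)] unfolding l_def by blast
  obtain \<rho> where \<rho>: "\<rho> > 0" "ball z0 \<rho> \<subseteq> range V" using z0(1) by (auto simp: mem_interior)
  \<comment> \<open>keeps \<open>z\<close> in the range of \<open>V\<close> and within reach of the perturbed lower bound\<close>
  define d where "d = min \<rho> (1 / (2 * (C + 1)))"
  have "d > 0" using \<rho> C by (simp add: d_def)
  from generic_log_integrable[OF cont per this, of z0] obtain t where t: "\<bar>t\<bar> < d"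
    and int: "integrable torus (\<lambda>\<theta>. ln (cmod (V \<theta> - (z0 + complex_of_real t))))"
    and ne: "AE \<theta> in torus. V \<theta> \<noteq> z0 + complex_of_real t" by blast
  define z where "z = z0 + complex_of_real t"
  have dz: "cmod (z - z0) < d" using t by (simp add: z_def)
  then have "z \<in> ball z0 \<rho>" by (simp add: d_def dist_norm norm_minus_commute)
  then obtain \<theta>0 where \<theta>0: "V \<theta>0 = z" using \<rho>(2) by blast
  have "C * cmod (z - z0) \<le> 1/2"
  proof -
    have "C * cmod (z - z0) \<le> (C + 1) * (1 / (2 * (C + 1)))"
      using dz C(1) by (intro mult_mono) (auto simp: d_def)
    also have "\<dots> = 1/2" using C(1) by (simp add: field_simps)
    finally show ?thesis .
  qed
  then have low: "dual_lower_bound V \<alpha> l (V \<theta>0) (2 * C)"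
    unfolding \<theta>0 by (rule dual_lower_bound_nearby[OF C(2,1)])
  have bound: "cmod l ^ m * (\<Prod>k=Suc m..<N. cmod (V (\<theta>0 + real k *\<^sub>R \<alpha>) - z)) \<le> 2 * C * cmod l ^ N"
    if "m < N" for m N
    using orbit_product_bound[OF cont per indep low _ that] C(1) by (simp add: \<theta>0)
  \<comment> \<open>for \<open>m = 0\<close> and \<open>N = 1\<close> the bound reads \<open>1 \<le> 2 * C * cmod l\<close>\<close>
  have l: "cmod l > 0" using bound[of 0 1] by auto
  define g where "g \<theta> = V \<theta> - z" for \<theta>
  have g_cont: "continuous_on UNIV g" unfolding g_def[abs_def] by (intro continuous_intros cont)
  have g_per: "g (x + lat k) = g x" for x k using per by (simp add: g_def torus_periodic_def)
  have prod_bound: "(\<Prod>k<n. cmod (g (\<theta> + real k *\<^sub>R \<alpha>))) \<le> 2 * C * cmod l ^ Suc n" for n \<theta>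
  proof -
    define \<Phi> where "\<Phi> x = (\<Prod>k<n. cmod (g (x + real k *\<^sub>R \<alpha>)))" for x
    have "continuous_on UNIV \<Phi>"
      unfolding \<Phi>_def[abs_def] by (intro continuous_intros continuous_on_compose2[OF g_cont]) auto
    moreover have "\<Phi> (x + lat p) = \<Phi> x" for x p
      using g_per[of "x + real _ *\<^sub>R \<alpha>" p] by (simp add: \<Phi>_def add_ac)
    moreover have "\<Phi> (\<theta>0 + real j *\<^sub>R \<alpha>) \<le> 2 * C * cmod l ^ Suc n" if "j > 0" for j
    proof -
      from that obtain m where m: "j = Suc m" by (cases j) auto
      have "(\<Prod>k<n. cmod (g (\<theta>0 + real j *\<^sub>R \<alpha> + real k *\<^sub>R \<alpha>))) = (\<Prod>k<n. cmod (g (\<theta>0 + real (k + j) *\<^sub>R \<alpha>)))"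
        by (simp add: algebra_simps)
      also have "\<dots> = (\<Prod>k=Suc m..<Suc m + n. cmod (V (\<theta>0 + real k *\<^sub>R \<alpha>) - z))"
        unfolding g_def m using prod.shift_bounds_nat_ivl[of "\<lambda>k. cmod (V (\<theta>0 + real k *\<^sub>R \<alpha>) - z)" 0 "Suc m" n]
        by (simp add: lessThan_atLeast0 add.commute)
      finally have "cmod l ^ m * (\<Prod>k<n. cmod (g (\<theta>0 + real j *\<^sub>R \<alpha> + real k *\<^sub>R \<alpha>))) \<le> 2 * C * cmod l ^ (Suc m + n)"
        using bound[of m "Suc m + n"] by simp
      also have "\<dots> = cmod l ^ m * (2 * C * cmod l ^ Suc n)" by (simp add: power_add)
      finally show ?thesis
        unfolding \<Phi>_def using l by (simp only: mult_le_cancel_left_pos zero_less_power)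
    qed
    ultimately have "\<Phi> \<theta> \<le> 2 * C * cmod l ^ Suc n"
      by (rule periodic_le_of_orbit[OF indep])
    then show ?thesis by (simp only: \<Phi>_def)
  qed
  have "(\<integral>\<theta>. ln (cmod (g \<theta>)) \<partial>torus) \<le> ln (cmod l)"
  proof (rule log_mean_le_of_product_bound[OF _ g_per _ _ prod_bound l])
    show "g \<in> borel_measurable borel" using g_cont by (rule borel_measurable_continuous_onI)
  qed (use int ne in \<open>auto simp: g_def z_def\<close>)
  moreover have "G V z = (\<integral>\<theta>. ln (cmod (g \<theta>)) \<partial>torus)"
  proof -
    have [measurable]: "V \<in> borel_measurable borel" using cont by (rule borel_measurable_continuous_onI)
    have "G V z = (\<integral>\<theta>. ln (cmod (z - V \<theta>)) \<partial>torus)"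
      unfolding G_def by (rule LINT_cube_eq_torus) measurable
    then show ?thesis by (simp add: g_def norm_minus_commute)
  qed
  ultimately have "exp (G V z) \<le> exp (ln (cmod l))" by simp
  also have "\<dots> = cmod lam" using l norm_l by simp
  finally have "exp (G V z) \<le> cmod lam" .
  moreover have "exp_min_G V \<le> exp (G V z)"
    unfolding exp_min_G_def by (rule cINF_lower[OF bdd_belowI2[where m=0]]) auto
  ultimately show False using small by simp
qed

theorem corollary1p1:
  fixes V :: "real ^ 'd \<Rightarrow> complex" and \<alpha> \<theta>t :: "real ^ 'd" and \<omega> :: real and lam :: complex
  assumes "rationally_independent \<alpha>"
    and "torus_periodic V" and "real_analytic V"
    and "rank (ReIm_jacobian V \<theta>t) = 2"
    and "cmod lam < exp_min_G V"
  shows "two_dimensional (ell2_spectrum (H V \<alpha> lam \<omega>))"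
proof -
  have "V \<theta>t \<in> interior (range V)"
    using assms(3,4) by (rule value_interior_of_range)
  moreover have "interior (range V) \<subseteq> interior (ell2_spectrum (H V \<alpha> lam \<omega>))"
    using interior_range_subset_spectrum[OF real_analytic_continuous[OF assms(3)] assms(2,1,5)]
    by (simp add: interior_maximal)
  ultimately show ?thesis unfolding two_dimensional_def by blast
qed

end
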